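(* Let $u\in W^{1,1}_{\mathrm{loc}}(\Omega,\mathbb{S}^{N-1})$ be a local minimizer of the functional $\mathcal F(w,\Omega)=\int_\Omega F(x,w,Dw)\,dx$, where $F$, $H$, $a$, $p$, $q$ satisfy all the assumptions listed in the context. Let $\delta_g>0$ be the higher integrability exponent described in the context, so that $H(\cdot,Du)\in L^{1+\delta_g}_{\mathrm{loc}}(\Omega)$, and let $\Omega_u\subset\Omega$ be the regular set of $u$ and $\Sigma_u=\Omega\setminus\Omega_u$ its singular set, as described in the context. Assume that $q(1+\delta_g)\le n$. Then $$\mathcal H_{H^{1+\delta_g}}(\Omega\setminus\Omega_u)=0\quad\text{and therefore}\quad Cap_{H^{1+\delta_g}}(\Omega\setminus\Omega_u)=0.$$ In particular, $$\mathcal H^{n-p-p\delta_g}(\Sigma_u)=0\qquad\text{and}\qquad\mathcal H^{n-q-q\delta_g}\big(\Sigma_u\cap\{a(x)>0\}\big)=0,$$ where $\mathcal H^s$ is the usual $s$-dimensional Hausdorff measure.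
   Context: $n\ge2$ and $N>1$ are integers, $\Omega\subset\mathbb{R}^n$ is a bounded open domain, $\mathbb{S}^{N-1}\subset\mathbb{R}^N$ is the unit sphere. Let $1<p<q$, $\alpha\in(0,1]$, $0\le a(\cdot)\in C^{0,\alpha}(\Omega)$ with Hölder seminorm $[a]_{0,\alpha}$ on $\Omega$, and assume $p<q<p+\alpha$ and $q<N$. Set $H(x,z):=|z|^p+a(x)|z|^q$ for $x\in\Omega$, $z\in\mathbb{R}^{N\times n}$ (and $H(x,t)=t^p+a(x)t^q$ for $t\ge0$). For a ball $B\Subset\Omega$ set $H^-_B(t):=t^p+(\inf_{B}a)t^q$. $F:\Omega\times\mathbb{R}^N\times\mathbb{R}^{N\times n}\to\mathbb{R}$ is a Carathéodory integrand, with $z\mapsto F(x,v,z)$ in $C^1(\mathbb{R}^{N\times n})\cap C^2(\mathbb{R}^{N\times n}\setminus\{0\})$; $\partial$ denotes the derivative in $z$. Fix $0<\nu\le1\le L$, $\beta\in(0,1]$, $\omega(t):=\min\{t^\beta,1\}$. For all $x,x_1,x_2\in\Omega$, $v,v_1,v_2\in\mathbb{R}^N$, $z\in\mathbb{R}^{N\times n}\setminus\{0\}$, $\xi\in\mathbb{R}^{N\times n}$: (1) $\nu H(x,z)\le F(x,v,z)\le LH(x,z)$; (2) $|\partial F(x,v,z)||z|+|\partial^2F(x,v,z)||z|^2\le LH(x,z)$; (3) $\nu(|z|^{p-2}+a(x)|z|^{q-2})|\xi|^2\le\langle\partial^2F(x,v,z)\xi,\xi\rangle$; (4) $|\partial F(x_1,v,z)-\partial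 F(x_2,v,z)||z|\le L\omega(|x_1-x_2|)[H(x_1,z)+H(x_2,z)]+L|a(x_1)-a(x_2)||z|^q$; (5) $|F(x,v_1,z)-F(x,v_2,z)|\le L\omega(|v_1-v_2|)H(x,z)$. Moreover, for every $(x,v)\in\Omega\times\mathbb{R}^N$ there is $\tilde F(x,v,\cdot):[0,\infty)\to[0,\infty)$ of class $C^1[0,\infty)\cap C^2(0,\infty)$, non-decreasing in $t$, with $F(x,v,z)=\tilde F(x,v,|z|)$, and for a fixed $\beta_1\in(0,1]$ (independent of $(x,v)$), $|\tilde F''(x,v,t+s)-\tilde F''(x,v,t)|\le\frac{LH(x,t)}{t^2}(|s|/t)^{\beta_1}$ for all $t>0$, $s\in\mathbb{R}$ with $2|s|<t$. A map $u\in W^{1,1}_{\mathrm{loc}}(\Omega,\mathbb{S}^{N-1})$ (i.e. $|u|=1$ a.e.) is a local minimizer of $\mathcal F$ if $H(\cdot,Du)\in L^1_{\mathrm{loc}}(\Omega)$ and $\mathcal F(u,\operatorname{supp}(u-v))\le\mathcal F(v,\operatorname{supp}(u-v))$ for every $v\in W^{1,1}_{\mathrm{loc}}(\Omega,\mathbb{S}^{N-1})$ such that $\operatorname{supp}(u-v)$ is a compact subset of $\Omega$; here $\mathcal F(w,A)=\int_AF(x,w,Dw)\,dx$. Exponent and regular set: there is $\delta_g>0$, depending only on $(n,N,\nu,L,p,q,\alpha,[a]_{0,\alpha})$, such that $H(\cdot,Du)\in L^{1+\delta_g}_{\mathrm{loc}}(\Omega)$ for every such local minimizer; this $\delta_g$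 is fixed. The singular set of $u$ is $$\Sigma_u=\left\{x_0\in\Omega:\ \limsup_{\varrho\to0}\left[H^-_{B_\varrho(x_0)}\left(\tfrac1\varrho\right)\right]^{-1}\frac{1}{|B_\varrho(x_0)|}\int_{B_\varrho(x_0)}H(x,Du)\,dx>0\right\},$$ and the regular set is $\Omega_u=\Omega\setminus\Sigma_u$, which is an open set of full measure on which $Du$ is locally Hölder continuous. Weighted Hausdorff measure and capacity: let $\Phi(x,t)=[H(x,t)]^{1+\delta_g}$. For an open ball $B\subset\Omega$ of radius $r(B)$ set $h_\Phi(B)=\int_B\Phi(x,1/r(B))\,dx$. For $E\subset\Omega$, $0<\kappa\le1$, let $\mathcal H_{\Phi,\kappa}(E)=\inf\sum_jh_\Phi(B_j)$, the infimum over countable collections of balls $B_j\subset\Omega$ covering $E$ with $r(B_j)\le\kappa$, and $\mathcal H_{H^{1+\delta_g}}(E)=\lim_{\kappa\to0}\mathcal H_{\Phi,\kappa}(E)$. Let $W^{1,\Phi}(\Omega)=\{f\in W^{1,1}(\Omega):\Phi(\cdot,|f|)+\Phi(\cdot,|Df|)\in L^1(\Omega)\}$ and $C_0(\Omega)$ be the continuous functions with compact support in $\Omega$. For compact $K\subset\Omega$, $Cap^*_\Phi(K)=\inf\int_\Omega\Phi(x,|Df|)\,dx$ over $f\in W^{1,\Phi}(\Omega)\cap C_0(\Omega)$ with $f\ge1$ in $K$ and $f\ge0$; for open $U\subset\Omega$, $Cap_\Phi(U)=\sup\{Cap^*_\Phi(K):K\subset U\text{ compact}\}$; for general $E\subset\Omega$,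 $Cap_{H^{1+\delta_g}}(E)=Cap_\Phi(E)=\inf\{Cap_\Phi(\tilde U):E\subset\tilde U\subset\Omega,\ \tilde U\text{ open}\}$. *)

theory Defs
  imports "HOL-Analysis.Analysis"
begin

section \<open>Classical derivatives\<close>

definition grad :: "('a::euclidean_space \<Rightarrow> real) \<Rightarrow> 'a \<Rightarrow> 'a" where
  "grad f z = (\<Sum>b\<in>Basis. frechet_derivative f (at z) b *\<^sub>R b)"

text \<open>The Hessian is the linear map with \<open>\<langle>\<partial>\<^sup>2f(z) \<xi>, \<eta>\<rangle> = hess f z \<xi> \<bullet> \<eta>\<close>;
  its size is measured by the Euclidean norm of the tensor of second derivatives.\<close>

definition hess :: "('a::euclidean_space \<Rightarrow> real) \<Rightarrow> 'a \<Rightarrow> 'a \<Rightarrow> 'a" where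
  "hess f z = frechet_derivative (grad f) (at z)"

definition hess_norm :: "('a::euclidean_space \<Rightarrow> real) \<Rightarrow> 'a \<Rightarrow> real" where
  "hess_norm f z = L2_set (\<lambda>b. norm (hess f z b)) Basis"

text \<open>The following two are meant for open \<open>S\<close>.\<close>

definition C1_on :: "'a::euclidean_space set \<Rightarrow> ('a \<Rightarrow> real) \<Rightarrow> bool" where
  "C1_on S f \<longleftrightarrow> (\<forall>z\<in>S. f differentiable (at z)) \<and> continuous_on S (grad f)"

definition C2_on :: "'a::euclidean_space set \<Rightarrow> ('a \<Rightarrow> real) \<Rightarrow> bool" where
  "C2_on S f \<longleftrightarrow> C1_on S f \<and> (\<forall>z\<in>S. grad f differentiable (at z)) \<and>
     (\<forall>\<xi>. continuous_on S (\<lambda>z. hess f z \<xi>))"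

primrec Ck :: "nat \<Rightarrow> ('a::euclidean_space \<Rightarrow> real) \<Rightarrow> bool" where
  "Ck 0 f \<longleftrightarrow> continuous_on UNIV f"
| "Ck (Suc k) f \<longleftrightarrow> (\<forall>x. f differentiable (at x)) \<and>
     (\<forall>b\<in>Basis. Ck k (\<lambda>x. frechet_derivative f (at x) b))"

section \<open>Weak derivatives and Sobolev spaces\<close>

text \<open>Functions with compact support in \<open>\<Omega>\<close> are identified with their extension by zero to the
  whole space. Other functions \<open>\<Omega> \<rightarrow> _\<close> are total functions whose values outside \<open>\<Omega>\<close> play no role.\<close>

definition compact_support_in :: "'a::euclidean_space set \<Rightarrow> ('a \<Rightarrow> real) \<Rightarrow> bool" where
  "compact_support_in \<Omega> f \<longleftrightarrow> compact (closure {x. f x \<noteq> 0}) \<and> closure {x. f x \<noteq> 0} \<subseteq> \<Omega>"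

definition test_function :: "'a::euclidean_space set \<Rightarrow> ('a \<Rightarrow> real) \<Rightarrow> bool" where
  "test_function \<Omega> \<phi> \<longleftrightarrow> (\<forall>k. Ck k \<phi>) \<and> compact_support_in \<Omega> \<phi>"

definition L1_loc :: "'a::euclidean_space set \<Rightarrow> ('a \<Rightarrow> 'b::euclidean_space) \<Rightarrow> bool" where
  "L1_loc \<Omega> f \<longleftrightarrow> (\<forall>K. compact K \<and> K \<subseteq> \<Omega> \<longrightarrow> f absolutely_integrable_on K)"

definition has_weak_gradient ::
  "'a::euclidean_space set \<Rightarrow> ('a \<Rightarrow> real) \<Rightarrow> ('a \<Rightarrow> 'a) \<Rightarrow> bool" where
  "has_weak_gradient \<Omega> f g \<longleftrightarrow> L1_loc \<Omega> f \<and> L1_loc \<Omega> g \<and>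
     (\<forall>\<phi>. test_function \<Omega> \<phi> \<longrightarrow> (\<forall>b\<in>Basis.
        (LINT x:\<Omega>|lebesgue. f x * frechet_derivative \<phi> (at x) b)
          = - (LINT x:\<Omega>|lebesgue. (g x \<bullet> b) * \<phi> x)))"

text \<open>Row \<open>j\<close> of the Jacobian matrix is the gradient of the \<open>j\<close>-th component. On
  \<open>real^'n^'m\<close> the library norm and inner product are the Euclidean (Frobenius) ones.\<close>

definition has_weak_jacobian ::
  "(real^'n) set \<Rightarrow> (real^'n \<Rightarrow> real^'m) \<Rightarrow> (real^'n \<Rightarrow> real^'n^'m) \<Rightarrow> bool" where
  "has_weak_jacobian \<Omega> u G \<longleftrightarrow> (\<forall>j. has_weak_gradient \<Omega> (\<lambda>x. u x $ j) (\<lambda>x. G x $ j))"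

text \<open>Weak derivatives are unique up to null sets; these pick a representative.\<close>

definition weak_gradient :: "'a::euclidean_space set \<Rightarrow> ('a \<Rightarrow> real) \<Rightarrow> 'a \<Rightarrow> 'a" where
  "weak_gradient \<Omega> f = (SOME g. has_weak_gradient \<Omega> f g)"

definition weak_jacobian ::
  "(real^'n) set \<Rightarrow> (real^'n \<Rightarrow> real^'m) \<Rightarrow> real^'n \<Rightarrow> real^'n^'m" where
  "weak_jacobian \<Omega> u = (SOME G. has_weak_jacobian \<Omega> u G)"

definition W11_loc_sphere :: "(real^'n) set \<Rightarrow> (real^'n \<Rightarrow> real^'m) set" where
  "W11_loc_sphere \<Omega> =
     {u. (\<exists>G. has_weak_jacobian \<Omega> u G) \<and> (AE x in lebesgue. x \<in> \<Omega> \<longrightarrow> u x \<in> sphere 0 1)}"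

text \<open>Support, relative to \<open>\<Omega>\<close>, of a function defined almost everywhere.\<close>

definition ess_supp :: "'a::euclidean_space set \<Rightarrow> ('a \<Rightarrow> 'b::real_normed_vector) \<Rightarrow> 'a set" where
  "ess_supp \<Omega> w =
     {x\<in>\<Omega>. \<forall>r>0. \<not> (AE y in lebesgue. y \<in> ball x r \<inter> \<Omega> \<longrightarrow> w y = 0)}"

section \<open>The double phase integrand\<close>

definition H :: "('a \<Rightarrow> real) \<Rightarrow> real \<Rightarrow> real \<Rightarrow> 'a \<Rightarrow> real \<Rightarrow> real" where
  "H a p q x t = t powr p + a x * t powr q"

definition H_minus :: "('a \<Rightarrow> real) \<Rightarrow> real \<Rightarrow> real \<Rightarrow> 'a set \<Rightarrow> real \<Rightarrow> real" where
  "H_minus a p q B t = t powr p + (INF x\<in>B. a x) * t powr q"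

definition holder_quotients :: "real \<Rightarrow> ('a::metric_space \<Rightarrow> real) \<Rightarrow> 'a set \<Rightarrow> real set" where
  "holder_quotients \<alpha> a \<Omega> =
     {\<bar>a x - a y\<bar> / dist x y powr \<alpha> | x y. x \<in> \<Omega> \<and> y \<in> \<Omega> \<and> x \<noteq> y}"

definition holder_continuous_on :: "real \<Rightarrow> 'a::metric_space set \<Rightarrow> ('a \<Rightarrow> real) \<Rightarrow> bool" where
  "holder_continuous_on \<alpha> \<Omega> a \<longleftrightarrow> bounded (a ` \<Omega>) \<and> bdd_above (holder_quotients \<alpha> a \<Omega>)"

definition holder_seminorm :: "real \<Rightarrow> ('a::metric_space \<Rightarrow> real) \<Rightarrow> 'a set \<Rightarrow> real" where
  "holder_seminorm \<alpha> a \<Omega> = Sup (holder_quotients \<alpha> a \<Omega>)"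

definition modulus :: "real \<Rightarrow> real \<Rightarrow> real" where
  "modulus \<beta> t = min (t powr \<beta>) 1"

definition caratheodory ::
  "(real^'n) set \<Rightarrow> (real^'n \<Rightarrow> real^'m \<Rightarrow> real^'n^'m \<Rightarrow> real) \<Rightarrow> bool" where
  "caratheodory \<Omega> F \<longleftrightarrow>
     (\<forall>v z. (\<lambda>x. F x v z) \<in> borel_measurable (lebesgue_on \<Omega>)) \<and>
     (AE x in lebesgue. x \<in> \<Omega> \<longrightarrow> continuous_on UNIV (\<lambda>(v, z). F x v z))"

text \<open>\<open>\<phi>\<close> is a radial profile of class \<open>C\<^sup>1[0,\<infinity>) \<inter> C\<^sup>2(0,\<infinity>)\<close> with derivatives
  \<open>\<phi>'\<close>, \<open>\<phi>''\<close>; \<open>h\<close> stands for \<open>H(x,\<cdot>)\<close>.\<close>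

definition radial_profile ::
  "real \<Rightarrow> real \<Rightarrow> (real \<Rightarrow> real) \<Rightarrow> (real \<Rightarrow> real) \<Rightarrow> (real \<Rightarrow> real) \<Rightarrow> (real \<Rightarrow> real) \<Rightarrow> bool" where
  "radial_profile L \<beta>1 h \<phi> \<phi>' \<phi>'' \<longleftrightarrow>
     (\<forall>t\<ge>0. 0 \<le> \<phi> t) \<and> mono_on {0..} \<phi> \<and>
     (\<forall>t\<ge>0. (\<phi> has_real_derivative \<phi>' t) (at t within {0..})) \<and> continuous_on {0..} \<phi>' \<and>
     (\<forall>t>0. (\<phi>' has_real_derivative \<phi>'' t) (at t)) \<and> continuous_on {0<..} \<phi>'' \<and>
     (\<forall>t>0. \<forall>s. 2 * \<bar>s\<bar> < t \<longrightarrow>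
        \<bar>\<phi>'' (t + s) - \<phi>'' t\<bar> \<le> L * h t / t\<^sup>2 * (\<bar>s\<bar> / t) powr \<beta>1)"

locale double_phase_problem =
  fixes \<nu> L p q \<alpha> \<beta> \<beta>1 :: real
    and \<Omega> :: "(real^'n) set"
    and a :: "real^'n \<Rightarrow> real"
    and F :: "real^'n \<Rightarrow> real^'m \<Rightarrow> real^'n^'m \<Rightarrow> real"
  assumes dims: "2 \<le> CARD('n)" "1 < CARD('m)"
    and domain: "open \<Omega>" "connected \<Omega>" "bounded \<Omega>" "\<Omega> \<noteq> {}"
    and constants: "0 < \<nu>" "\<nu> \<le> 1" "1 \<le> L" "0 < \<beta>" "\<beta> \<le> 1" "0 < \<beta>1" "\<beta>1 \<le> 1"
    and exponents: "1 < p" "p < q" "0 < \<alpha>" "\<alpha> \<le> 1" "q < p + \<alpha>" "q < real CARD('m)"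
    and coeff_nonneg: "\<And>x. x \<in> \<Omega> \<Longrightarrow> 0 \<le> a x"
    and coeff_holder: "holder_continuous_on \<alpha> \<Omega> a"
    and F_caratheodory: "caratheodory \<Omega> F"
    and F_C1: "\<And>x v. x \<in> \<Omega> \<Longrightarrow> C1_on UNIV (F x v)"
    and F_C2: "\<And>x v. x \<in> \<Omega> \<Longrightarrow> C2_on (- {0}) (F x v)"
    and F_growth: "\<And>x v z. x \<in> \<Omega> \<Longrightarrow> z \<noteq> 0 \<Longrightarrow>
      \<nu> * H a p q x (norm z) \<le> F x v z \<and> F x v z \<le> L * H a p q x (norm z)"
    and F_deriv_growth: "\<And>x v z. x \<in> \<Omega> \<Longrightarrow> z \<noteq> 0 \<Longrightarrow>
      norm (grad (F x v) z) * norm z + hess_norm (F x v) z * (norm z)\<^sup>2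
        \<le> L * H a p q x (norm z)"
    and F_elliptic: "\<And>x v z \<xi>. x \<in> \<Omega> \<Longrightarrow> z \<noteq> 0 \<Longrightarrow>
      \<nu> * (norm z powr (p - 2) + a x * norm z powr (q - 2)) * (norm \<xi>)\<^sup>2
        \<le> hess (F x v) z \<xi> \<bullet> \<xi>"
    and F_continuity_x: "\<And>x1 x2 v z. x1 \<in> \<Omega> \<Longrightarrow> x2 \<in> \<Omega> \<Longrightarrow> z \<noteq> 0 \<Longrightarrow>
      norm (grad (F x1 v) z - grad (F x2 v) z) * norm z
        \<le> L * modulus \<beta> (norm (x1 - x2)) * (H a p q x1 (norm z) + H a p q x2 (norm z))
          + L * \<bar>a x1 - a x2\<bar> * norm z powr q"
    and F_continuity_v: "\<And>x v1 v2 z. x \<in> \<Omega> \<Longrightarrow> z \<noteq> 0 \<Longrightarrow>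
      \<bar>F x v1 z - F x v2 z\<bar> \<le> L * modulus \<beta> (norm (v1 - v2)) * H a p q x (norm z)"
    and F_radial: "\<And>x v. x \<in> \<Omega> \<Longrightarrow>
      \<exists>\<phi> \<phi>' \<phi>''. radial_profile L \<beta>1 (H a p q x) \<phi> \<phi>' \<phi>'' \<and> (\<forall>z. F x v z = \<phi> (norm z))"

section \<open>Local minimizers and their singular sets\<close>

text \<open>On \<open>\<Omega>\<close> the integrand is nonnegative, so the energy is an element of \<open>[0,\<infinity>]\<close>.\<close>

definition energy ::
  "(real^'n) set \<Rightarrow> (real^'n \<Rightarrow> real^'m \<Rightarrow> real^'n^'m \<Rightarrow> real) \<Rightarrow>
    (real^'n \<Rightarrow> real^'m) \<Rightarrow> (real^'n) set \<Rightarrow> ennreal" where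
  "energy \<Omega> F w A = (\<integral>\<^sup>+x\<in>A. ennreal (F x (w x) (weak_jacobian \<Omega> w x)) \<partial>lebesgue)"

definition local_minimizer ::
  "real \<Rightarrow> real \<Rightarrow> (real^'n) set \<Rightarrow> (real^'n \<Rightarrow> real) \<Rightarrow>
    (real^'n \<Rightarrow> real^'m \<Rightarrow> real^'n^'m \<Rightarrow> real) \<Rightarrow> (real^'n \<Rightarrow> real^'m) \<Rightarrow> bool" where
  "local_minimizer p q \<Omega> a F u \<longleftrightarrow>
     u \<in> W11_loc_sphere \<Omega> \<and>
     L1_loc \<Omega> (\<lambda>x. H a p q x (norm (weak_jacobian \<Omega> u x))) \<and>
     (\<forall>v\<in>W11_loc_sphere \<Omega>.
        let S = ess_supp \<Omega> (\<lambda>x. u x - v x)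
        in compact S \<longrightarrow> energy \<Omega> F u S \<le> energy \<Omega> F v S)"

text \<open>The type arguments carry the dimensions \<open>n\<close> and \<open>N\<close>: \<open>\<delta>\<close> is a higher integrability exponent
  that works for all problems with the same \<open>n, N, \<nu>, L, p, q, \<alpha>\<close> and Hoelder seminorm \<open>A\<close>.\<close>

definition higher_integrability_exponent ::
  "'n::finite itself \<Rightarrow> 'm::finite itself \<Rightarrow> real \<Rightarrow> real \<Rightarrow> real \<Rightarrow> real \<Rightarrow> real \<Rightarrow> real \<Rightarrow> real \<Rightarrow> bool" where
  "higher_integrability_exponent (_ :: 'n itself) (_ :: 'm itself) \<nu> L p q \<alpha> A \<delta> \<longleftrightarrow>
     0 < \<delta> \<and>
     (\<forall>\<beta> \<beta>1 (\<Omega> :: (real^'n) set) a (F :: real^'n \<Rightarrow> real^'m \<Rightarrow> real^'n^'m \<Rightarrow> real) u.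
        double_phase_problem \<nu> L p q \<alpha> \<beta> \<beta>1 \<Omega> a F \<longrightarrow>
        holder_seminorm \<alpha> a \<Omega> = A \<longrightarrow>
        local_minimizer p q \<Omega> a F u \<longrightarrow>
        L1_loc \<Omega> (\<lambda>x. H a p q x (norm (weak_jacobian \<Omega> u x)) powr (1 + \<delta>)))"

definition singular_set ::
  "real \<Rightarrow> real \<Rightarrow> (real^'n) set \<Rightarrow> (real^'n \<Rightarrow> real) \<Rightarrow> (real^'n \<Rightarrow> real^'m) \<Rightarrow> (real^'n) set" where
  "singular_set p q \<Omega> a u =
     {x0\<in>\<Omega>. Limsup (at_right 0) (\<lambda>\<rho>. ereal (
        inverse (H_minus a p q (ball x0 \<rho>) (1 / \<rho>)) *
        (1 / measure lebesgue (ball x0 \<rho>) *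
          (LINT x:ball x0 \<rho>|lebesgue. H a p q x (norm (weak_jacobian \<Omega> u x)))))) > 0}"

definition regular_set ::
  "real \<Rightarrow> real \<Rightarrow> (real^'n) set \<Rightarrow> (real^'n \<Rightarrow> real) \<Rightarrow> (real^'n \<Rightarrow> real^'m) \<Rightarrow> (real^'n) set" where
  "regular_set p q \<Omega> a u = \<Omega> - singular_set p q \<Omega> a u"

section \<open>Weighted Hausdorff measures and capacities\<close>

text \<open>A ball is represented by the pair of its centre and its radius.\<close>

definition h_gauge ::
  "('a::euclidean_space \<Rightarrow> real \<Rightarrow> real) \<Rightarrow> 'a \<times> real \<Rightarrow> ennreal" where
  "h_gauge \<Phi> = (\<lambda>(c, r). \<integral>\<^sup>+x\<in>ball c r. ennreal (\<Phi> x (1 / r)) \<partial>lebesgue)"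

definition ball_covers ::
  "'a::euclidean_space set \<Rightarrow> real \<Rightarrow> 'a set \<Rightarrow> ('a \<times> real) set set" where
  "ball_covers \<Omega> \<kappa> E =
     {C. countable C \<and> (\<forall>(c, r)\<in>C. 0 < r \<and> r \<le> \<kappa> \<and> ball c r \<subseteq> \<Omega>) \<and> E \<subseteq> (\<Union>(c, r)\<in>C. ball c r)}"

definition weighted_hausdorff_pre ::
  "'a::euclidean_space set \<Rightarrow> ('a \<Rightarrow> real \<Rightarrow> real) \<Rightarrow> real \<Rightarrow> 'a set \<Rightarrow> ennreal" where
  "weighted_hausdorff_pre \<Omega> \<Phi> \<kappa> E = (INF C\<in>ball_covers \<Omega> \<kappa> E. infsum (h_gauge \<Phi>) C)"

definition weighted_hausdorff ::
  "'a::euclidean_space set \<Rightarrow> ('a \<Rightarrow> real \<Rightarrow> real) \<Rightarrow> 'a set \<Rightarrow> ennreal" where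
  "weighted_hausdorff \<Omega> \<Phi> E = Lim (at_right 0) (\<lambda>\<kappa>. weighted_hausdorff_pre \<Omega> \<Phi> \<kappa> E)"

definition W1Phi :: "'a::euclidean_space set \<Rightarrow> ('a \<Rightarrow> real \<Rightarrow> real) \<Rightarrow> ('a \<Rightarrow> real) set" where
  "W1Phi \<Omega> \<Phi> =
     {f. (\<exists>g. has_weak_gradient \<Omega> f g) \<and>
         f absolutely_integrable_on \<Omega> \<and> weak_gradient \<Omega> f absolutely_integrable_on \<Omega> \<and>
         (\<lambda>x. \<Phi> x \<bar>f x\<bar> + \<Phi> x (norm (weak_gradient \<Omega> f x))) absolutely_integrable_on \<Omega>}"

definition C0 :: "'a::euclidean_space set \<Rightarrow> ('a \<Rightarrow> real) set" where
  "C0 \<Omega> = {f. continuous_on UNIV f \<and> compact_support_in \<Omega> f}"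

definition cap_compact ::
  "'a::euclidean_space set \<Rightarrow> ('a \<Rightarrow> real \<Rightarrow> real) \<Rightarrow> 'a set \<Rightarrow> ennreal" where
  "cap_compact \<Omega> \<Phi> K =
     (INF f\<in>{f \<in> W1Phi \<Omega> \<Phi> \<inter> C0 \<Omega>. (\<forall>x\<in>K. 1 \<le> f x) \<and> (\<forall>x\<in>\<Omega>. 0 \<le> f x)}.
        \<integral>\<^sup>+x\<in>\<Omega>. ennreal (\<Phi> x (norm (weak_gradient \<Omega> f x))) \<partial>lebesgue)"

definition cap_open ::
  "'a::euclidean_space set \<Rightarrow> ('a \<Rightarrow> real \<Rightarrow> real) \<Rightarrow> 'a set \<Rightarrow> ennreal" where
  "cap_open \<Omega> \<Phi> U = (SUP K\<in>{K. compact K \<and> K \<subseteq> U}. cap_compact \<Omega> \<Phi> K)"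

definition capacity ::
  "'a::euclidean_space set \<Rightarrow> ('a \<Rightarrow> real \<Rightarrow> real) \<Rightarrow> 'a set \<Rightarrow> ennreal" where
  "capacity \<Omega> \<Phi> E = (INF U\<in>{U. open U \<and> E \<subseteq> U \<and> U \<subseteq> \<Omega>}. cap_open \<Omega> \<Phi> U)"

section \<open>Hausdorff measure\<close>

text \<open>Since \<open>0 powr 0 = 0\<close>, dimension zero needs a separate clause: every nonempty set has gauge
  \<open>1\<close> there, which makes the zero-dimensional measure the counting measure.\<close>

definition hausdorff_gauge :: "real \<Rightarrow> 'a::metric_space set \<Rightarrow> ennreal" where
  "hausdorff_gauge s U =
     (if U = {} then 0 else if s = 0 then 1
      else ennreal (unit_ball_vol s * (diameter U / 2) powr s))"

definition hausdorff_pre :: "real \<Rightarrow> real \<Rightarrow> 'a::metric_space set \<Rightarrow> ennreal" where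
  "hausdorff_pre s \<kappa> E =
     (INF \<U>\<in>{\<U>. countable \<U> \<and> (\<forall>U\<in>\<U>. bounded U \<and> diameter U \<le> \<kappa>) \<and> E \<subseteq> \<Union>\<U>}.
        infsum (hausdorff_gauge s) \<U>)"

definition hausdorff_measure :: "real \<Rightarrow> 'a::metric_space set \<Rightarrow> ennreal" where
  "hausdorff_measure s E = Lim (at_right 0) (\<lambda>\<kappa>. hausdorff_pre s \<kappa> E)"

end

theory Submission
  imports Defs
begin

text \<open>
  Write \<open>s = 1 + \<delta>\<close>, \<open>\<Phi> = H\<^sup>s\<close> and \<open>f = H(\<cdot>, Du)\<^sup>s\<close>, which is locally integrable by the choice of
  \<open>\<delta>\<close>. A singular point is the centre of arbitrarily small balls \<open>B\<close> of radius \<open>\<rho>\<close> on which the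
  mean of \<open>H(\<cdot>, Du)\<close> is at least \<open>\<theta> H\<^sup>-\<^sub>B(1/\<rho>)\<close>. Jensen's inequality turns this into
  \<open>|B| H\<^sup>-\<^sub>B(1/\<rho>)\<^sup>s \<le> K \<integral>\<^sub>B f\<close>. Because of \<open>q < p + \<alpha>\<close> the coefficient varies so little that
  \<open>H(x, 1/\<rho>) \<le> C H\<^sup>-\<^sub>B(1/\<rho>)\<close> on the tenfold ball (\<open>H_le_H_minus\<close>), so the weighted gauge of the
  enlarged ball is at most a multiple of \<open>\<integral>\<^sub>B f\<close>. Moreover \<open>|B| \<le> K \<rho>\<^sup>p\<^sup>s \<integral>\<^sub>B f\<close>.

  Vitali's covering lemma now gives covers of the singular set by fivefold enlargements of
  disjoint balls of this kind. The second inequality shows that the set has Lebesgue measure zero.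
  It therefore has open neighbourhoods \<open>U\<close> (after localization) with \<open>\<integral>\<^sub>U f\<close> arbitrarily small,
  and by the first inequality a Vitali cover inside \<open>U\<close> has small total gauge
  (\<open>gauge_null_Vitali\<close>, \<open>gauge_null_Limsup_means\<close>).

  The gauge used integrates \<open>\<Phi>(x, 1/r)\<close> over the doubled ball, and smallness for it implies all
  assertions. It dominates the gauge of the weighted Hausdorff measure. It also dominates
  \<open>r\<^sup>n\<^sup>-\<^sup>p\<^sup>s\<close>, and \<open>r\<^sup>n\<^sup>-\<^sup>q\<^sup>s\<close> near points with \<open>a > 0\<close>, which are the gauges of the two classical
  Hausdorff measures. For the capacity, a compact subset of the union of a cover is covered by
  finitely many of the balls, and an admissible function for it is \<open>2 M / (1 + M)\<close> with \<open>M\<close> a sum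
  of high powers of bumps on the doubled balls. With these powers the modular of its gradient is
  at most a constant times the sum of the gauges, however much the balls overlap
  (\<open>\<Phi>_cutoff_grad_le\<close>). Since the weak gradient in the capacity is an arbitrary representative,
  this needs that weak gradients are unique up to null sets and agree with classical ones for
  \<open>C\<^sup>1\<close> functions of compact support (\<open>weak_gradient_eq_grad\<close>).
\<close>

section \<open>Covers by balls of small total gauge\<close>

lemma infsum_ennreal_le:
  fixes T :: "'b \<Rightarrow> ennreal"
  assumes "\<And>F. finite F \<Longrightarrow> F \<subseteq> C \<Longrightarrow> sum T F \<le> e"
  shows "infsum T C \<le> e"
  by (rule infsum_le_finite_sums) (use assms in \<open>auto intro: nonneg_summable_on_complete\<close>)

text \<open>The common form of the four smallness statements: arbitrarily fine covers by balls whose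
  doubles stay in \<open>\<Omega>\<close>, of arbitrarily small total gauge \<open>T\<close>. The room for the doubled ball is
  needed for the cutoff functions of the capacity estimate. The total gauge is bounded through
  finite partial sums, which avoids all summability questions in \<open>[0,\<infinity>]\<close>.\<close>

definition gauge_null :: "'a::euclidean_space set \<Rightarrow> ('a \<times> real \<Rightarrow> ennreal) \<Rightarrow> 'a set \<Rightarrow> bool" where
  "gauge_null \<Omega> T E \<longleftrightarrow> (\<forall>\<kappa>>0. \<forall>\<epsilon>>0. \<exists>C. countable C \<and>
     (\<forall>(c, r)\<in>C. 0 < r \<and> r \<le> \<kappa> \<and> cball c (2 * r) \<subseteq> \<Omega>) \<and>
     E \<subseteq> (\<Union>(c, r)\<in>C. ball c r) \<and> (\<forall>F. finite F \<longrightarrow> F \<subseteq> C \<longrightarrow> sum T F \<le> ennreal \<epsilon>))"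

text \<open>Only the balls that meet the set matter, and only small ones, so a gauge may be replaced by
  another that it dominates in this restricted sense. This is how one cover serves several
  measures.\<close>

lemma gauge_null_compare:
  assumes E: "gauge_null \<Omega> T E" and "E' \<subseteq> E" and "0 < \<kappa>0" and K: "0 < K"
    and le: "\<And>c r. 0 < r \<Longrightarrow> r \<le> \<kappa>0 \<Longrightarrow> cball c (2 * r) \<subseteq> \<Omega> \<Longrightarrow> ball c r \<inter> E' \<noteq> {} \<Longrightarrow>
      T' (c, r) \<le> ennreal K * T (c, r)"
  shows "gauge_null \<Omega> T' E'"
  unfolding gauge_null_def
proof (intro allI impI)
  fix \<kappa> \<epsilon> :: real assume "0 < \<kappa>" "0 < \<epsilon>"
  then have "0 < min \<kappa> \<kappa>0" "0 < \<epsilon> / K" using assms by auto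
  with E obtain C where C: "countable C"
    "\<forall>(c, r)\<in>C. 0 < r \<and> r \<le> min \<kappa> \<kappa>0 \<and> cball c (2 * r) \<subseteq> \<Omega>"
    "E \<subseteq> (\<Union>(c, r)\<in>C. ball c r)"
    "\<forall>F. finite F \<longrightarrow> F \<subseteq> C \<longrightarrow> sum T F \<le> ennreal (\<epsilon> / K)"
    unfolding gauge_null_def by meson
  define C' where "C' = {(c, r)\<in>C. ball c r \<inter> E' \<noteq> {}}"
  have "C' \<subseteq> C" by (auto simp: C'_def)
  have fin: "sum T' F \<le> ennreal \<epsilon>" if "finite F" "F \<subseteq> C'" for F
  proof -
    have "sum T' F \<le> (\<Sum>x\<in>F. ennreal K * T x)"
    proof (rule sum_mono)
      fix x assume "x \<in> F"
      obtain c r where x: "x = (c, r)" by (cases x)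
      with \<open>x \<in> F\<close> that have "(c, r) \<in> C'" by blast
      then show "T' x \<le> ennreal K * T x" using C(2) unfolding x by (intro le) (auto simp: C'_def)
    qed
    also have "\<dots> = ennreal K * sum T F" by (simp add: sum_distrib_left)
    also have "\<dots> \<le> ennreal K * ennreal (\<epsilon> / K)"
      using C(4) that \<open>C' \<subseteq> C\<close> by (intro mult_left_mono) auto
    also have "\<dots> = ennreal \<epsilon>" using K \<open>0 < \<epsilon>\<close> by (simp flip: ennreal_mult)
    finally show ?thesis .
  qed
  show "\<exists>C. countable C \<and> (\<forall>(c, r)\<in>C. 0 < r \<and> r \<le> \<kappa> \<and> cball c (2 * r) \<subseteq> \<Omega>) \<and>
     E' \<subseteq> (\<Union>(c, r)\<in>C. ball c r) \<and> (\<forall>F. finite F \<longrightarrow> F \<subseteq> C \<longrightarrow> sum T' F \<le> ennreal \<epsilon>)"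
  proof (intro exI conjI allI impI)
    show "countable C'" using C(1) \<open>C' \<subseteq> C\<close> by (rule countable_subset[rotated])
    show "\<forall>(c, r)\<in>C'. 0 < r \<and> r \<le> \<kappa> \<and> cball c (2 * r) \<subseteq> \<Omega>" using C(2) \<open>C' \<subseteq> C\<close> by auto
    show "E' \<subseteq> (\<Union>(c, r)\<in>C'. ball c r)"
    proof
      fix x assume "x \<in> E'"
      then obtain c r where "(c, r) \<in> C" "x \<in> ball c r" using C(3) \<open>E' \<subseteq> E\<close> by blast
      with \<open>x \<in> E'\<close> have "(c, r) \<in> C'" by (auto simp: C'_def)
      with \<open>x \<in> ball c r\<close> show "x \<in> (\<Union>(c, r)\<in>C'. ball c r)" by blast
    qed
  qed (rule fin)
qed

text \<open>Countable subadditivity: the \<open>i\<close>-th set gets a cover of total gauge \<open>\<epsilon> / 2\<^sup>i\<^sup>+\<^sup>1\<close>.\<close>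

lemma gauge_null_UN:
  assumes E: "\<And>i::nat. gauge_null \<Omega> T (E i)"
  shows "gauge_null \<Omega> T (\<Union>i. E i)"
  unfolding gauge_null_def
proof (intro allI impI)
  fix \<kappa> \<epsilon> :: real assume pos: "0 < \<kappa>" "0 < \<epsilon>"
  define Q where "Q i C \<longleftrightarrow> countable C \<and> (\<forall>(c, r)\<in>C. 0 < r \<and> r \<le> \<kappa> \<and> cball c (2 * r) \<subseteq> \<Omega>) \<and>
     E i \<subseteq> (\<Union>(c, r)\<in>C. ball c r) \<and>
     (\<forall>F. finite F \<longrightarrow> F \<subseteq> C \<longrightarrow> sum T F \<le> ennreal (\<epsilon> * (1/2) ^ Suc i))" for i C
  have "\<exists>C. Q i C" for i
  proof -
    have "0 < \<epsilon> * (1/2) ^ Suc i" using pos by simp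
    with E[of i] pos(1) show ?thesis unfolding gauge_null_def Q_def by blast
  qed
  then obtain C where Q: "Q i (C i)" for i by metis
  have C: "\<And>i. countable (C i)"
    "\<And>i. \<forall>(c, r)\<in>C i. 0 < r \<and> r \<le> \<kappa> \<and> cball c (2 * r) \<subseteq> \<Omega>"
    "\<And>i. E i \<subseteq> (\<Union>(c, r)\<in>C i. ball c r)"
    "\<And>i F. finite F \<Longrightarrow> F \<subseteq> C i \<Longrightarrow> sum T F \<le> ennreal (\<epsilon> * (1/2) ^ Suc i)"
    using Q unfolding Q_def by auto
  have fin: "sum T F \<le> ennreal (\<epsilon> * (1 - (1/2) ^ M))"
    if "finite F" "F \<subseteq> (\<Union>i<M. C i)" for F M
    using that
  proof (induction M arbitrary: F)
    case (Suc M)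
    have "sum T F = sum T (F \<inter> C M) + sum T (F - C M)"
      using Suc.prems(1) by (metis sum.Int_Diff)
    also have "\<dots> \<le> ennreal (\<epsilon> * (1/2) ^ Suc M) + ennreal (\<epsilon> * (1 - (1/2) ^ M))"
      using Suc.prems by (intro add_mono C(4) Suc.IH) (auto simp: lessThan_Suc)
    also have "\<dots> = ennreal (\<epsilon> * (1/2) ^ Suc M + \<epsilon> * (1 - (1/2) ^ M))"
      using pos by (intro ennreal_plus[symmetric]) (auto simp: power_le_one)
    also have "\<epsilon> * (1/2) ^ Suc M + \<epsilon> * (1 - (1/2) ^ M) = \<epsilon> * (1 - (1/2) ^ Suc M)"
      by (simp add: field_simps)
    finally show ?case .
  qed auto
  have "sum T F \<le> ennreal \<epsilon>" if F: "finite F" "F \<subseteq> (\<Union>i. C i)" for F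
  proof -
    obtain I where I: "finite I" "F \<subseteq> (\<Union>i\<in>I. C i)"
      using finite_subset_Union[of F "range C"] F by (metis finite_subset_image Union_UNIV UN_I)
    then obtain M where "I \<subseteq> {..<M}" using finite_nat_iff_bounded by blast
    with I have "F \<subseteq> (\<Union>i<M. C i)" by blast
    from fin[OF F(1) this] have "sum T F \<le> ennreal (\<epsilon> * (1 - (1/2) ^ M))" .
    also have "\<dots> \<le> ennreal \<epsilon>" using pos by (intro ennreal_leI) (simp add: algebra_simps)
    finally show ?thesis .
  qed
  moreover have "(\<Union>i. E i) \<subseteq> (\<Union>(c, r)\<in>(\<Union>i. C i). ball c r)"
    using C(3) unfolding UN_UN_flatten by (rule UN_mono[OF subset_refl])
  moreover have "\<forall>(c, r)\<in>(\<Union>i. C i). 0 < r \<and> r \<le> \<kappa> \<and> cball c (2 * r) \<subseteq> \<Omega>" using C(2) by blast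
  moreover have "countable (\<Union>i. C i)" using C(1) by auto
  ultimately show "\<exists>C. countable C \<and> (\<forall>(c, r)\<in>C. 0 < r \<and> r \<le> \<kappa> \<and> cball c (2 * r) \<subseteq> \<Omega>) \<and>
     (\<Union>i. E i) \<subseteq> (\<Union>(c, r)\<in>C. ball c r) \<and> (\<forall>F. finite F \<longrightarrow> F \<subseteq> C \<longrightarrow> sum T F \<le> ennreal \<epsilon>)"
    by (intro exI[of _ "\<Union>i. C i"] conjI allI impI)
qed

section \<open>The Vitali covering argument\<close>

text \<open>If each point of \<open>E\<close> is the centre of arbitrarily small balls with a property \<open>P\<close>, Vitali's
  lemma yields disjoint such balls whose fivefold enlargements cover \<open>E\<close>. Disjointness lets any
  measure \<open>\<nu>\<close> sum to at most \<open>\<nu> U\<close> over them; the tenfold enlargement is the double of a covering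
  ball.\<close>

lemma Vitali_selection:
  fixes E :: "'a::euclidean_space set" and \<nu> :: "'a measure"
  assumes sets: "sets \<nu> = sets lebesgue" and U: "open U" "E \<subseteq> U"
    and "0 < \<kappa>"
    and P: "\<forall>x\<in>E. \<forall>\<delta>>0. \<exists>\<rho>. 0 < \<rho> \<and> \<rho> < \<delta> \<and> P x \<rho>"
  shows "\<exists>C. countable C \<and>
    (\<forall>x \<rho>. (x, \<rho>) \<in> C \<longrightarrow> x \<in> E \<and> 0 < \<rho> \<and> 5 * \<rho> \<le> \<kappa> \<and> P x \<rho> \<and> cball x (10 * \<rho>) \<subseteq> U) \<and>
    E \<subseteq> (\<Union>(x, \<rho>)\<in>C. ball x (5 * \<rho>)) \<and>
    (\<forall>F. finite F \<longrightarrow> F \<subseteq> C \<longrightarrow> (\<Sum>(x, \<rho>)\<in>F. emeasure \<nu> (ball x \<rho>)) \<le> emeasure \<nu> U)"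
proof -
  define K where "K = {(x, \<rho>). x \<in> E \<and> 0 < \<rho> \<and> 5 * \<rho> \<le> \<kappa> \<and> P x \<rho> \<and> cball x (10 * \<rho>) \<subseteq> U}"
  have "E \<subseteq> (\<Union>i\<in>K. ball (fst i) (snd i))"
  proof
    fix x assume x: "x \<in> E"
    then obtain e where e: "0 < e" "cball x e \<subseteq> U" using U open_contains_cball by blast
    have "0 < min (e / 10) (\<kappa> / 5)" using e \<open>0 < \<kappa>\<close> by simp
    with P x obtain \<rho> where "0 < \<rho>" "\<rho> < min (e / 10) (\<kappa> / 5)" "P x \<rho>" by blast
    then have "0 < \<rho>" "\<rho> < e / 10" "\<rho> < \<kappa> / 5" "P x \<rho>" by auto
    moreover have "cball x (10 * \<rho>) \<subseteq> U"
      using e \<open>\<rho> < e / 10\<close> by (intro order_trans[OF _ e(2)] subset_cball) auto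
    ultimately have "(x, \<rho>) \<in> K" "x \<in> ball x \<rho>" using x by (auto simp: K_def)
    then show "x \<in> (\<Union>i\<in>K. ball (fst i) (snd i))" by force
  qed
  moreover have "0 < snd i \<and> snd i \<le> \<kappa> / 5" if "i \<in> K" for i using that by (auto simp: K_def)
  ultimately obtain C where C: "countable C" "C \<subseteq> K"
     "pairwise (\<lambda>i j. disjnt (ball (fst i) (snd i)) (ball (fst j) (snd j))) C"
     "E \<subseteq> (\<Union>i\<in>C. ball (fst i) (5 * snd i))"
    by (rule Vitali_covering_lemma_balls)
  show ?thesis
  proof (intro exI[of _ C] conjI[OF C(1)] conjI allI impI)
    fix x \<rho> assume "(x, \<rho>) \<in> C"
    then have "x \<in> E \<and> 0 < \<rho> \<and> 5 * \<rho> \<le> \<kappa> \<and> P x \<rho> \<and> cball x (10 * \<rho>) \<subseteq> U"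
      using C(2) by (auto simp: K_def)
    then show "x \<in> E" "0 < \<rho>" "5 * \<rho> \<le> \<kappa>" "P x \<rho>" "cball x (10 * \<rho>) \<subseteq> U" by blast+
  next
    show "E \<subseteq> (\<Union>(x, \<rho>)\<in>C. ball x (5 * \<rho>))" using C(4) by (auto simp: case_prod_beta)
  next
    fix F assume F: "finite F" "F \<subseteq> C"
    have ms: "ball x \<rho> \<in> sets \<nu>" "U \<in> sets \<nu>" for x \<rho> using U unfolding sets by auto
    have "disjoint_family_on (\<lambda>i. ball (fst i) (snd i)) F"
      using C(3) F(2) unfolding disjoint_family_on_def pairwise_def disjnt_def by (meson subsetD)
    then have "(\<Sum>i\<in>F. emeasure \<nu> (ball (fst i) (snd i))) = emeasure \<nu> (\<Union>i\<in>F. ball (fst i) (snd i))"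
      using F ms by (intro sum_emeasure) auto
    also have "\<dots> \<le> emeasure \<nu> U"
    proof (rule emeasure_mono[OF _ ms(2)])
      have "ball (fst i) (snd i) \<subseteq> U" if "i \<in> F" for i
      proof -
        from that F C(2) have "i \<in> K" by blast
        then have i: "0 < snd i" "cball (fst i) (10 * snd i) \<subseteq> U"
          unfolding K_def by (auto simp: case_prod_beta)
        then have "ball (fst i) (snd i) \<subseteq> cball (fst i) (10 * snd i)" by auto
        with i show ?thesis by blast
      qed
      then show "(\<Union>i\<in>F. ball (fst i) (snd i)) \<subseteq> U" by blast
    qed
    finally show "(\<Sum>(x, \<rho>)\<in>F. emeasure \<nu> (ball x \<rho>)) \<le> emeasure \<nu> U" by (simp add: case_prod_beta)
  qed
qed

text \<open>Absolute continuity of a finite measure: outer regularity of Lebesgue measure gives open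
  neighbourhoods that decrease to a null set, and \<open>\<nu>\<close> is continuous along them.\<close>

lemma open_superset_small_measure:
  fixes E :: "'a::euclidean_space set" and \<nu> :: "'a measure"
  assumes sets: "sets \<nu> = sets lebesgue" and ac: "absolutely_continuous lebesgue \<nu>"
    and V: "open V" "E \<subseteq> V" "emeasure \<nu> V < \<infinity>" and E: "E \<in> null_sets lebesgue" and "0 < \<epsilon>"
  obtains U where "open U" "E \<subseteq> U" "U \<subseteq> V" "emeasure \<nu> U \<le> ennreal \<epsilon>"
proof -
  have "\<exists>U. open U \<and> E \<subseteq> U \<and> emeasure lebesgue U \<le> ennreal ((1/2) ^ n)" for n
  proof -
    have "E \<in> sets lebesgue" "(0::real) < (1/2) ^ n" using E by auto
    then obtain U where U: "open U" "E \<subseteq> U" "emeasure lebesgue (U - E) < ennreal ((1/2) ^ n)"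
      by (rule sets_lebesgue_outer_open)
    have "emeasure lebesgue U = emeasure lebesgue (U - E)"
      using U E by (simp add: emeasure_Diff_null_set)
    with U show ?thesis by auto
  qed
  then obtain U where U: "\<And>n. open (U n)" "\<And>n. E \<subseteq> U n"
    "\<And>n. emeasure lebesgue (U n) \<le> ennreal ((1/2) ^ n)" by metis
  define W where "W n = V \<inter> (\<Inter>i\<le>n. U i)" for n :: nat
  have W: "open (W n)" "E \<subseteq> W n" "W n \<subseteq> V" "W n \<subseteq> U n" for n
    using U V by (auto simp: W_def)
  have ms: "W n \<in> sets \<nu>" "V \<in> sets \<nu>" for n using W(1)[of n] V unfolding sets by auto
  have msl: "W n \<in> sets lebesgue" for n using W(1)[of n] by auto
  have "emeasure lebesgue (\<Inter>n. W n) \<le> ennreal ((1/2) ^ n)" for n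
    using emeasure_mono[of "\<Inter>n. W n" "U n" lebesgue] W(4)[of n] U(1)[of n] U(3)[of n]
    by (force intro: order_trans)
  moreover have "(\<lambda>n. ennreal ((1/2) ^ n)) \<longlonglongrightarrow> ennreal 0"
    by (intro tendsto_ennrealI LIMSEQ_power_zero) auto
  ultimately have "emeasure lebesgue (\<Inter>n. W n) \<le> 0"
    using LIMSEQ_le_const by (metis ennreal_0)
  then have "(\<Inter>n. W n) \<in> null_sets lebesgue" using msl by (auto intro!: null_setsI)
  then have "emeasure \<nu> (\<Inter>n. W n) = 0" using ac by (auto simp: absolutely_continuous_def)
  moreover have "emeasure \<nu> (W n) \<noteq> \<infinity>" for n
    using emeasure_mono[OF W(3)[of n] ms(2)] V(3) by (auto simp: top_unique)
  ultimately have "(\<lambda>n. emeasure \<nu> (W n)) \<longlonglongrightarrow> 0"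
    using Lim_emeasure_decseq[of W \<nu>] ms by (force simp: W_def decseq_def)
  then have "\<forall>\<^sub>F n in sequentially. emeasure \<nu> (W n) < ennreal \<epsilon>"
    using \<open>0 < \<epsilon>\<close> by (intro order_tendstoD(2)) auto
  then obtain n where "emeasure \<nu> (W n) < ennreal \<epsilon>" by (auto simp: eventually_sequentially)
  with W[of n] show ?thesis by (intro that[of "W n"]) auto
qed

text \<open>Infinite upper density of \<open>\<nu>\<close> forces Lebesgue measure zero: the selected balls have total
  Lebesgue measure at most \<open>\<eta> \<nu>(V)\<close> with \<open>\<eta>\<close> as small as desired.\<close>

lemma null_sets_Vitali:
  fixes E :: "'a::euclidean_space set" and \<nu> :: "'a measure"
  assumes sets: "sets \<nu> = sets lebesgue" and V: "open V" "E \<subseteq> V" "emeasure \<nu> V < \<infinity>"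
    and P: "\<And>x \<delta>. x \<in> E \<Longrightarrow> 0 < \<delta> \<Longrightarrow>
      \<exists>\<rho>. 0 < \<rho> \<and> \<rho> < \<delta> \<and> emeasure lebesgue (ball x \<rho>) \<le> ennreal \<delta> * emeasure \<nu> (ball x \<rho>)"
  shows "E \<in> null_sets lebesgue"
proof -
  define m where "m = enn2real (emeasure \<nu> V)"
  have m: "emeasure \<nu> V = ennreal m" "0 \<le> m" using V(3) by (auto simp: m_def)
  have "\<exists>W. E \<subseteq> W \<and> W \<in> lmeasurable \<and> measure lebesgue W \<le> e" if "0 < e" for e
  proof -
    \<comment> \<open>The fivefold balls cost a factor \<open>5\<^sup>n\<close>; the summand \<open>1\<close> allows for \<open>m = 0\<close>.\<close>
    define \<eta> where "\<eta> = e / (5 ^ DIM('a) * (m + 1))"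
    have \<eta>: "0 < \<eta>" using that m by (auto simp: \<eta>_def)
    have P': "\<forall>x\<in>E. \<forall>\<delta>>0. \<exists>\<rho>. 0 < \<rho> \<and> \<rho> < \<delta> \<and>
        emeasure lebesgue (ball x \<rho>) \<le> ennreal \<eta> * emeasure \<nu> (ball x \<rho>)"
    proof (intro ballI allI impI)
      fix x \<delta> assume x: "x \<in> E" "0 < (\<delta>::real)"
      have "0 < min \<delta> \<eta>" using \<eta> x by simp
      from P[OF x(1) this] obtain \<rho> where \<rho>: "0 < \<rho>" "\<rho> < min \<delta> \<eta>"
        "emeasure lebesgue (ball x \<rho>) \<le> ennreal (min \<delta> \<eta>) * emeasure \<nu> (ball x \<rho>)" by blast
      have "ennreal (min \<delta> \<eta>) * emeasure \<nu> (ball x \<rho>) \<le> ennreal \<eta> * emeasure \<nu> (ball x \<rho>)"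
        by (intro mult_right_mono ennreal_leI) auto
      with \<rho> show "\<exists>\<rho>. 0 < \<rho> \<and> \<rho> < \<delta> \<and>
        emeasure lebesgue (ball x \<rho>) \<le> ennreal \<eta> * emeasure \<nu> (ball x \<rho>)"
        by (intro exI[of _ \<rho>]) auto
    qed
    obtain C where C: "countable C"
      "\<forall>x \<rho>. (x, \<rho>) \<in> C \<longrightarrow> x \<in> E \<and> 0 < \<rho> \<and> 5 * \<rho> \<le> 1 \<and>
         emeasure lebesgue (ball x \<rho>) \<le> ennreal \<eta> * emeasure \<nu> (ball x \<rho>) \<and> cball x (10 * \<rho>) \<subseteq> V"
      "E \<subseteq> (\<Union>(x, \<rho>)\<in>C. ball x (5 * \<rho>))"
      "\<forall>F. finite F \<longrightarrow> F \<subseteq> C \<longrightarrow> (\<Sum>(x, \<rho>)\<in>F. emeasure \<nu> (ball x \<rho>)) \<le> emeasure \<nu> V"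
      using Vitali_selection[where P = "\<lambda>x \<rho>. emeasure lebesgue (ball x \<rho>) \<le> ennreal \<eta> * emeasure \<nu> (ball x \<rho>)",
          OF sets V(1,2) zero_less_one P'] by (elim exE conjE)
    define A where "A i = ball (fst i) (5 * snd i)" for i :: "'a \<times> real"
    have mA: "A i \<in> lmeasurable" for i by (auto simp: A_def)
    have bound: "measure lebesgue (\<Union>i\<in>F. A i) \<le> e" if F: "finite F" "F \<subseteq> C" for F
    proof -
      have "ennreal (\<Sum>i\<in>F. measure lebesgue (ball (fst i) (snd i)))
          = (\<Sum>i\<in>F. ennreal (measure lebesgue (ball (fst i) (snd i))))" by simp
      also have "\<dots> = (\<Sum>i\<in>F. emeasure lebesgue (ball (fst i) (snd i)))"
        by (intro sum.cong refl emeasure_eq_measure2[symmetric]) auto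
      also have "\<dots> \<le> (\<Sum>i\<in>F. ennreal \<eta> * emeasure \<nu> (ball (fst i) (snd i)))"
        using C(2) F by (intro sum_mono) (metis prod.collapse subsetD)
      also have "\<dots> = ennreal \<eta> * (\<Sum>(x, \<rho>)\<in>F. emeasure \<nu> (ball x \<rho>))"
        by (simp add: sum_distrib_left case_prod_beta)
      also have "\<dots> \<le> ennreal \<eta> * ennreal m"
        using C(4) F m by (intro mult_left_mono) auto
      also have "\<dots> = ennreal (\<eta> * m)" using \<eta> m by (simp add: ennreal_mult)
      finally have 1: "(\<Sum>i\<in>F. measure lebesgue (ball (fst i) (snd i))) \<le> \<eta> * m"
        using \<eta> m by (simp add: ennreal_le_iff)
      have "measure lebesgue (\<Union>i\<in>F. A i) \<le> (\<Sum>i\<in>F. measure lebesgue (A i))"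
        using F mA by (intro measure_UNION_le) auto
      also have "\<dots> = (\<Sum>i\<in>F. 5 ^ DIM('a) * measure lebesgue (ball (fst i) (snd i)))"
      proof (rule sum.cong[OF refl])
        fix i assume "i \<in> F"
        then have "0 < snd i" using C(2) F by (metis prod.collapse subsetD)
        then show "measure lebesgue (A i) = 5 ^ DIM('a) * measure lebesgue (ball (fst i) (snd i))"
          by (simp add: A_def content_ball power_mult_distrib)
      qed
      also have "\<dots> \<le> 5 ^ DIM('a) * (\<eta> * m)"
        using 1 by (simp flip: sum_distrib_left)
      also have "\<dots> \<le> 5 ^ DIM('a) * (\<eta> * (m + 1))" using \<eta> by simp
      also have "\<dots> = e" using m by (simp add: \<eta>_def)
      finally show ?thesis .
    qed
    have "(\<Union>i\<in>C. A i) \<in> lmeasurable \<and> measure lebesgue (\<Union>i\<in>C. A i) \<le> e"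
      using fmeasurable_UN_bound[OF C(1), of A lebesgue e] measure_UN_bound[OF C(1), of A lebesgue e]
        mA bound by metis
    moreover have "E \<subseteq> (\<Union>i\<in>C. A i)" using C(3) by (auto simp: A_def case_prod_beta)
    ultimately show ?thesis by blast
  qed
  then have "negligible E" by (auto simp: negligible_outer_le)
  then show ?thesis by (simp add: negligible_iff_null_sets)
qed

text \<open>The covering argument behind all four assertions. The second part of \<open>P\<close> makes \<open>E\<close> a null
  set, so it has open neighbourhoods \<open>U\<close> with \<open>\<nu> U\<close> small; then a Vitali cover inside \<open>U\<close> has
  total gauge at most \<open>K \<nu>(U)\<close>.\<close>

lemma gauge_null_Vitali:
  fixes E :: "'a::euclidean_space set" and \<nu> :: "'a measure"
  assumes sets: "sets \<nu> = sets lebesgue" and ac: "absolutely_continuous lebesgue \<nu>"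
    and V: "open V" "E \<subseteq> V" "V \<subseteq> \<Omega>" "emeasure \<nu> V < \<infinity>" and "0 < K"
    and P: "\<And>x \<delta>. x \<in> E \<Longrightarrow> 0 < \<delta> \<Longrightarrow>
      \<exists>\<rho>. 0 < \<rho> \<and> \<rho> < \<delta> \<and> T (x, 5 * \<rho>) \<le> ennreal K * emeasure \<nu> (ball x \<rho>) \<and>
          emeasure lebesgue (ball x \<rho>) \<le> ennreal \<delta> * emeasure \<nu> (ball x \<rho>)"
  shows "gauge_null \<Omega> T E"
  unfolding gauge_null_def
proof (intro allI impI)
  fix \<kappa> \<epsilon> :: real assume pos: "0 < \<kappa>" "0 < \<epsilon>"
  have "E \<in> null_sets lebesgue"
    by (rule null_sets_Vitali[OF sets V(1,2,4)]) (use P in blast)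
  moreover have "0 < \<epsilon> / K" using pos \<open>0 < K\<close> by simp
  ultimately obtain U where U: "open U" "E \<subseteq> U" "U \<subseteq> V" "emeasure \<nu> U \<le> ennreal (\<epsilon> / K)"
    using open_superset_small_measure[OF sets ac V(1,2,4)] by blast
  have P': "\<forall>x\<in>E. \<forall>\<delta>>0. \<exists>\<rho>. 0 < \<rho> \<and> \<rho> < \<delta> \<and> T (x, 5 * \<rho>) \<le> ennreal K * emeasure \<nu> (ball x \<rho>)"
    using P by blast
  obtain C where C: "countable C"
    "\<forall>x \<rho>. (x, \<rho>) \<in> C \<longrightarrow> x \<in> E \<and> 0 < \<rho> \<and> 5 * \<rho> \<le> \<kappa> \<and>
       T (x, 5 * \<rho>) \<le> ennreal K * emeasure \<nu> (ball x \<rho>) \<and> cball x (10 * \<rho>) \<subseteq> U"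
    "E \<subseteq> (\<Union>(x, \<rho>)\<in>C. ball x (5 * \<rho>))"
    "\<forall>F. finite F \<longrightarrow> F \<subseteq> C \<longrightarrow> (\<Sum>(x, \<rho>)\<in>F. emeasure \<nu> (ball x \<rho>)) \<le> emeasure \<nu> U"
    using Vitali_selection[where P = "\<lambda>x \<rho>. T (x, 5 * \<rho>) \<le> ennreal K * emeasure \<nu> (ball x \<rho>)",
        OF sets U(1,2) pos(1) P'] by (elim exE conjE)
  define g where "g = (\<lambda>i::'a \<times> real. (fst i, 5 * snd i))"
  have "inj g" by (auto simp: g_def inj_on_def prod_eq_iff)
  have fin: "sum T F \<le> ennreal \<epsilon>" if F: "finite F" "F \<subseteq> g ` C" for F
  proof -
    obtain F' where F': "F' \<subseteq> C" "finite F'" "F = g ` F'" using finite_subset_image[OF F] by blast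
    have "sum T F = (\<Sum>i\<in>F'. T (g i))"
      using \<open>inj g\<close> unfolding F' by (subst sum.reindex) (auto intro: inj_on_subset)
    also have "\<dots> \<le> (\<Sum>i\<in>F'. ennreal K * emeasure \<nu> (ball (fst i) (snd i)))"
      using C(2) F' by (intro sum_mono) (metis g_def prod.collapse subsetD)
    also have "\<dots> = ennreal K * (\<Sum>(x, \<rho>)\<in>F'. emeasure \<nu> (ball x \<rho>))"
      by (simp add: sum_distrib_left case_prod_beta)
    also have "\<dots> \<le> ennreal K * ennreal (\<epsilon> / K)"
      using C(4) F' U(4) by (intro mult_left_mono) (auto intro: order_trans)
    also have "\<dots> = ennreal \<epsilon>" using pos \<open>0 < K\<close> by (simp flip: ennreal_mult)
    finally show ?thesis .
  qed
  show "\<exists>C. countable C \<and> (\<forall>(c, r)\<in>C. 0 < r \<and> r \<le> \<kappa> \<and> cball c (2 * r) \<subseteq> \<Omega>) \<and>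
     E \<subseteq> (\<Union>(c, r)\<in>C. ball c r) \<and> (\<forall>F. finite F \<longrightarrow> F \<subseteq> C \<longrightarrow> sum T F \<le> ennreal \<epsilon>)"
  proof (intro exI[of _ "g ` C"] conjI allI impI)
    show "countable (g ` C)" using C(1) by simp
    show "\<forall>(c, r)\<in>g ` C. 0 < r \<and> r \<le> \<kappa> \<and> cball c (2 * r) \<subseteq> \<Omega>"
      using C(2) U(3) V(3) by (fastforce simp: g_def)
    show "E \<subseteq> (\<Union>(c, r)\<in>g ` C. ball c r)" using C(3) by (auto simp: g_def case_prod_beta)
  qed (rule fin)
qed

section \<open>The double phase integrand on small balls\<close>

text \<open>The gauge \<open>h_gauge\<close> with the integral extended over the doubled ball, the region in which
  the gradient of a cutoff function of the ball can live. It dominates \<open>h_gauge\<close>, so covers that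
  are small for it serve the capacity as well as the Hausdorff measures.\<close>

definition doubled_gauge ::
  "('a::euclidean_space \<Rightarrow> real \<Rightarrow> real) \<Rightarrow> 'a \<times> real \<Rightarrow> ennreal" where
  "doubled_gauge \<Phi> = (\<lambda>(c, r). \<integral>\<^sup>+x\<in>ball c (2 * r). ennreal (\<Phi> x (1 / r)) \<partial>lebesgue)"

text \<open>A form of Jensen's inequality \<open>(mean G)\<^sup>s \<le> mean G\<^sup>s\<close> up to a factor: below the level \<open>l\<close>
  the function contributes at most half of its mean, and above it \<open>G \<le> l\<^sup>1\<^sup>-\<^sup>s G\<^sup>s\<close>.\<close>

lemma powr_mean_lower_bound:
  fixes G :: "'a::euclidean_space \<Rightarrow> real"
  assumes B: "B \<in> lmeasurable" and G: "set_integrable lebesgue B G" "\<And>x. x \<in> B \<Longrightarrow> 0 \<le> G x"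
    and Gs: "set_integrable lebesgue B (\<lambda>x. G x powr s)" and "1 \<le> s" "0 < l"
    and mean: "2 * l * measure lebesgue B \<le> (LINT x:B|lebesgue. G x)"
  shows "l powr s * measure lebesgue B \<le> (LINT x:B|lebesgue. G x powr s)"
proof -
  have "G x \<le> l + l powr (1 - s) * G x powr s" if "x \<in> B" for x
  proof (cases "G x \<le> l")
    case False
    with \<open>0 < l\<close> have "l < G x" by simp
    have "G x * (l powr (s - 1) * l powr (1 - s)) \<le> G x * (G x powr (s - 1) * l powr (1 - s))"
      using \<open>1 \<le> s\<close> \<open>0 < l\<close> \<open>l < G x\<close> by (intro mult_left_mono mult_right_mono powr_mono2) auto
    also have "l powr (s - 1) * l powr (1 - s) = 1" using \<open>0 < l\<close> by (simp flip: powr_add)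
    also have "G x * (G x powr (s - 1) * l powr (1 - s)) = l powr (1 - s) * G x powr s"
      using \<open>0 < l\<close> \<open>l < G x\<close> by (simp add: powr_diff)
    finally show ?thesis using \<open>0 < l\<close> by simp
  qed (use \<open>0 < l\<close> in \<open>auto intro: add_increasing2\<close>)
  moreover have c: "set_integrable lebesgue B (\<lambda>x. l)"
    using B by (intro absolutely_integrable_on_const) auto
  moreover have d: "set_integrable lebesgue B (\<lambda>x. l powr (1 - s) * G x powr s)"
    using Gs by (intro set_integrable_mult_right) auto
  ultimately have "(LINT x:B|lebesgue. G x) \<le> (LINT x:B|lebesgue. l + l powr (1 - s) * G x powr s)"
    using G by (intro set_integral_mono set_integral_add(1)) auto
  also have "\<dots> = (LINT x:B|lebesgue. l) + (LINT x:B|lebesgue. l powr (1 - s) * G x powr s)"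
    using c d by (rule set_integral_add(2))
  also have "\<dots> = l * measure lebesgue B + l powr (1 - s) * (LINT x:B|lebesgue. G x powr s)"
    using B by (simp add: set_integral_const lmeasurable_iff_integrable set_lebesgue_integral_def mult.commute)
  finally have "l * measure lebesgue B \<le> l powr (1 - s) * (LINT x:B|lebesgue. G x powr s)"
    using mean by simp
  then have "l powr (s - 1) * (l * measure lebesgue B)
      \<le> l powr (s - 1) * (l powr (1 - s) * (LINT x:B|lebesgue. G x powr s))"
    by (intro mult_left_mono) auto
  moreover have "l powr (s - 1) * (l * c) = l powr s * c" for c using \<open>0 < l\<close> by (simp add: powr_diff)
  moreover have "l powr (s - 1) * (l powr (1 - s) * c) = c" for c
    using \<open>0 < l\<close> by (simp flip: powr_add mult.assoc)
  ultimately show ?thesis by simp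
qed

lemma Limsup_at_right_0_pos:
  fixes Q :: "real \<Rightarrow> real"
  assumes "0 < Limsup (at_right 0) (\<lambda>\<rho>. ereal (Q \<rho>))"
  obtains k :: nat where "\<And>\<delta>. 0 < \<delta> \<Longrightarrow> \<exists>\<rho>. 0 < \<rho> \<and> \<rho> < \<delta> \<and> 1 / real (Suc k) < Q \<rho>"
proof -
  from assms obtain c where c: "0 < ereal c" "ereal c < Limsup (at_right 0) (\<lambda>\<rho>. ereal (Q \<rho>))"
    using ereal_dense2 by blast
  then obtain k where k: "1 / real (Suc k) < c"
    using reals_Archimedean[of c] by (auto simp: inverse_eq_divide)
  have "\<exists>\<rho>. 0 < \<rho> \<and> \<rho> < \<delta> \<and> 1 / real (Suc k) < Q \<rho>" if "0 < \<delta>" for \<delta>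
  proof (rule ccontr)
    assume "\<not> ?thesis"
    then have "\<forall>\<^sub>F \<rho> in at_right 0. ereal (Q \<rho>) \<le> ereal c"
      using that k unfolding eventually_at_right_field by (intro exI[of _ \<delta>]) force
    then have "Limsup (at_right 0) (\<lambda>\<rho>. ereal (Q \<rho>)) \<le> ereal c" by (rule Limsup_bounded)
    with c show False by simp
  qed
  then show ?thesis by (rule that)
qed

text \<open>The setting of the covering argument. The exponent \<open>s\<close> stands for \<open>1 + \<delta>\<close> and \<open>A\<close> for a
  Hoelder constant of the coefficient.\<close>

locale double_phase_coeff =
  fixes p q \<alpha> s A :: real and \<Omega> :: "'a::euclidean_space set" and a :: "'a \<Rightarrow> real"
  assumes exps: "1 < p" "p < q" "q < p + \<alpha>" "0 < \<alpha>" "1 \<le> s" and A: "0 \<le> A"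
    and open_\<Omega>: "open \<Omega>"
    and a_nonneg: "\<And>x. x \<in> \<Omega> \<Longrightarrow> 0 \<le> a x"
    and a_holder: "\<And>x y. x \<in> \<Omega> \<Longrightarrow> y \<in> \<Omega> \<Longrightarrow> \<bar>a x - a y\<bar> \<le> A * dist x y powr \<alpha>"
begin

abbreviation \<Phi> :: "'a \<Rightarrow> real \<Rightarrow> real" where "\<Phi> x t \<equiv> H a p q x t powr s"

lemma H_nonneg: "x \<in> \<Omega> \<Longrightarrow> 0 \<le> H a p q x t"
  using a_nonneg by (simp add: H_def)

lemma H_minus_lower: "B \<noteq> {} \<Longrightarrow> B \<subseteq> \<Omega> \<Longrightarrow> t powr p \<le> H_minus a p q B t"
proof -
  assume B: "B \<noteq> {}" "B \<subseteq> \<Omega>"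
  then have "0 \<le> (INF x\<in>B. a x)" using a_nonneg by (intro cINF_greatest) auto
  then show ?thesis by (simp add: H_minus_def)
qed

text \<open>This is where \<open>q < p + \<alpha>\<close> enters: on the scale \<open>\<rho>\<close> the coefficient oscillates by at most a
  multiple of \<open>\<rho>\<^sup>\<alpha>\<close>, and \<open>\<rho>\<^sup>\<alpha> \<rho>\<^sup>-\<^sup>q \<le> \<rho>\<^sup>-\<^sup>p\<close>. Hence the integrand with the smallest coefficient on
  the ball controls the true one at the critical value \<open>1 / \<rho>\<close>, even on the tenfold ball.\<close>

lemma H_le_H_minus:
  assumes "0 < \<rho>" "\<rho> \<le> 1" and sub: "ball x (10 * \<rho>) \<subseteq> \<Omega>" and y: "y \<in> ball x (10 * \<rho>)"
  shows "H a p q y (1 / \<rho>) \<le> (1 + A * 11 powr \<alpha>) * H_minus a p q (ball x \<rho>) (1 / \<rho>)"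
proof -
  let ?i = "INF z\<in>ball x \<rho>. a z"
  have sub': "ball x \<rho> \<subseteq> \<Omega>" using \<open>0 < \<rho>\<close> by (intro order_trans[OF _ sub] subset_ball) auto
  have "a y - A * (11 * \<rho>) powr \<alpha> \<le> ?i"
  proof (rule cINF_greatest)
    show "ball x \<rho> \<noteq> {}" using \<open>0 < \<rho>\<close> by simp
    fix z assume z: "z \<in> ball x \<rho>"
    have "dist y z \<le> dist x y + dist x z" by (metis dist_commute dist_triangle)
    also have "\<dots> \<le> 11 * \<rho>" using y z by simp
    finally have "A * dist y z powr \<alpha> \<le> A * (11 * \<rho>) powr \<alpha>"
      using A exps by (intro mult_left_mono powr_mono2) auto
    moreover have "\<bar>a y - a z\<bar> \<le> A * dist y z powr \<alpha>" using a_holder sub sub' y z by blast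
    ultimately show "a y - A * (11 * \<rho>) powr \<alpha> \<le> a z" by linarith
  qed
  then have "a y * (1 / \<rho>) powr q \<le> (?i + A * (11 * \<rho>) powr \<alpha>) * (1 / \<rho>) powr q"
    by (intro mult_right_mono) auto
  also have "\<dots> = ?i * (1 / \<rho>) powr q + A * 11 powr \<alpha> * (\<rho> powr \<alpha> * (1 / \<rho>) powr q)"
    using \<open>0 < \<rho>\<close> by (simp add: algebra_simps powr_mult)
  also have "\<rho> powr \<alpha> * (1 / \<rho>) powr q = (1 / \<rho>) powr (q - \<alpha>)"
    using \<open>0 < \<rho>\<close> by (simp add: powr_divide powr_diff field_simps)
  also have "?i * (1 / \<rho>) powr q + A * 11 powr \<alpha> * (1 / \<rho>) powr (q - \<alpha>)
      \<le> ?i * (1 / \<rho>) powr q + A * 11 powr \<alpha> * (1 / \<rho>) powr p"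
    using assms exps A by (intro add_left_mono mult_left_mono powr_mono) auto
  finally have "H a p q y (1 / \<rho>)
      \<le> H_minus a p q (ball x \<rho>) (1 / \<rho>) + A * 11 powr \<alpha> * (1 / \<rho>) powr p"
    by (simp add: H_def H_minus_def)
  also have "\<dots> \<le> H_minus a p q (ball x \<rho>) (1 / \<rho>)
      + A * 11 powr \<alpha> * H_minus a p q (ball x \<rho>) (1 / \<rho>)"
    using A \<open>0 < \<rho>\<close> sub' by (intro add_left_mono mult_left_mono H_minus_lower) auto
  finally show ?thesis by (simp add: algebra_simps)
qed

definition growth_const :: real where
  "growth_const = 10 ^ DIM('a) * (1 + A * 11 powr \<alpha>) powr s"

lemma growth_const_pos: "0 < growth_const"
proof -
  have "0 < 1 + A * 11 powr \<alpha>" using A by (intro add_pos_nonneg) auto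
  then show ?thesis by (simp add: growth_const_def)
qed

lemma doubled_gauge_le:
  assumes "0 < \<rho>" "\<rho> \<le> 1" and sub: "ball x (10 * \<rho>) \<subseteq> \<Omega>"
  shows "doubled_gauge \<Phi> (x, 5 * \<rho>)
    \<le> ennreal (growth_const * (H_minus a p q (ball x \<rho>) (1 / \<rho>) powr s * measure lebesgue (ball x \<rho>)))"
proof -
  let ?h = "H_minus a p q (ball x \<rho>) (1 / \<rho>)" and ?K = "1 + A * 11 powr \<alpha>"
  have K: "0 \<le> ?K" using A by simp
  have sub': "ball x \<rho> \<subseteq> \<Omega>" using \<open>0 < \<rho>\<close> by (intro order_trans[OF _ sub] subset_ball) auto
  have h: "0 \<le> ?h" using H_minus_lower[OF _ sub', of "1 / \<rho>"] \<open>0 < \<rho>\<close> order_trans[OF powr_ge_zero] by fastforce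
  have le: "\<Phi> y (1 / (5 * \<rho>)) \<le> (?K * ?h) powr s" if y: "y \<in> ball x (10 * \<rho>)" for y
  proof (rule powr_mono2)
    have "y \<in> \<Omega>" using y sub by blast
    then show "0 \<le> H a p q y (1 / (5 * \<rho>))" by (rule H_nonneg)
    have "H a p q y (1 / (5 * \<rho>)) \<le> H a p q y (1 / \<rho>)"
      unfolding H_def using \<open>0 < \<rho>\<close> exps a_nonneg[OF \<open>y \<in> \<Omega>\<close>]
      by (intro add_mono mult_left_mono powr_mono2) (auto simp: field_simps)
    with H_le_H_minus[OF assms y] show "H a p q y (1 / (5 * \<rho>)) \<le> ?K * ?h" by linarith
  qed (use exps in auto)
  have "doubled_gauge \<Phi> (x, 5 * \<rho>)
      \<le> (\<integral>\<^sup>+y\<in>ball x (10 * \<rho>). ennreal ((?K * ?h) powr s) \<partial>lebesgue)"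
    unfolding doubled_gauge_def using le
    by (auto intro!: nn_integral_mono ennreal_leI split: split_indicator)
  also have "\<dots> = ennreal ((?K * ?h) powr s) * emeasure lebesgue (ball x (10 * \<rho>))"
    by (simp add: nn_integral_cmult_indicator)
  also have "emeasure lebesgue (ball x (10 * \<rho>)) = ennreal (measure lebesgue (ball x (10 * \<rho>)))"
    by (intro emeasure_eq_measure2) auto
  also have "measure lebesgue (ball x (10 * \<rho>)) = 10 ^ DIM('a) * measure lebesgue (ball x \<rho>)"
    using \<open>0 < \<rho>\<close> by (simp add: content_ball power_mult_distrib)
  also have "ennreal ((?K * ?h) powr s) * ennreal (10 ^ DIM('a) * measure lebesgue (ball x \<rho>))
      = ennreal (growth_const * (?h powr s * measure lebesgue (ball x \<rho>)))"
    using K h by (simp add: growth_const_def powr_mult mult_ac flip: ennreal_mult)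
  finally show ?thesis .
qed

text \<open>On a ball with large mean, \<open>powr_mean_lower_bound\<close> with \<open>l = \<theta> H\<^sup>- / 2\<close> bounds \<open>|B| (H\<^sup>-)\<^sup>s\<close>
  by a multiple of \<open>\<nu>(B)\<close>, where \<open>\<nu>\<close> has density \<open>H(x, g x)\<^sup>s\<close>. Since \<open>doubled_gauge_le\<close> bounds
  the gauge of the enlarged ball by the same quantity, and since \<open>H\<^sup>- \<ge> \<rho>\<^sup>-\<^sup>p\<close> is unbounded as
  \<open>\<rho> \<rightarrow> 0\<close>, both requirements of the Vitali argument hold.\<close>

lemma gauge_null_large_means:
  fixes g :: "'a \<Rightarrow> real"
  assumes C: "compact C" "C \<subseteq> \<Omega>"
    and G: "set_integrable lebesgue C (\<lambda>x. H a p q x (g x))"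
    and Gs: "set_integrable lebesgue C (\<lambda>x. \<Phi> x (g x))"
    and E: "E \<subseteq> interior C" and \<theta>: "0 < \<theta>"
    and large: "\<And>x \<delta>. x \<in> E \<Longrightarrow> 0 < \<delta> \<Longrightarrow> \<exists>\<rho>. 0 < \<rho> \<and> \<rho> < \<delta> \<and>
      \<theta> < inverse (H_minus a p q (ball x \<rho>) (1 / \<rho>)) *
        (1 / measure lebesgue (ball x \<rho>) * (LINT x:ball x \<rho>|lebesgue. H a p q x (g x)))"
  shows "gauge_null \<Omega> (doubled_gauge \<Phi>) E"
proof -
  let ?f = "\<lambda>x. indicator C x *\<^sub>R \<Phi> x (g x)"
  define \<nu> where "\<nu> = density lebesgue (\<lambda>x. ennreal (?f x))"
  define K where "K = (2 / \<theta>) powr s"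
  have K: "0 < K" using \<theta> by (simp add: K_def)
  have int: "integrable lebesgue ?f" using Gs by (simp add: set_integrable_def)
  then have meas: "(\<lambda>x. ennreal (?f x)) \<in> borel_measurable lebesgue" by simp
  have em: "emeasure \<nu> B = ennreal (LINT x:B|lebesgue. \<Phi> x (g x))"
    if B: "B \<in> sets lebesgue" "B \<subseteq> C" for B
  proof -
    have "set_integrable lebesgue B (\<lambda>x. \<Phi> x (g x))" using Gs B by (rule set_integrable_subset)
    moreover have "emeasure \<nu> B = (\<integral>\<^sup>+x. ennreal (indicator B x *\<^sub>R \<Phi> x (g x)) \<partial>lebesgue)"
      unfolding \<nu>_def using B meas
      by (subst emeasure_density) (auto intro!: nn_integral_cong split: split_indicator)
    ultimately show ?thesis unfolding set_lebesgue_integral_def set_integrable_def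
      by (simp add: nn_integral_eq_integral)
  qed
  show ?thesis
  proof (rule gauge_null_Vitali[where V = "interior C" and \<nu> = \<nu> and K = "growth_const * K"])
    show "sets \<nu> = sets lebesgue" by (simp add: \<nu>_def)
    show "absolutely_continuous lebesgue \<nu>"
      unfolding \<nu>_def using meas by (rule absolutely_continuousI_density)
    show "open (interior C)" "E \<subseteq> interior C" using E by auto
    show "interior C \<subseteq> \<Omega>" using C interior_subset by blast
    show "emeasure \<nu> (interior C) < \<infinity>" by (subst em) (auto simp: interior_subset)
    show "0 < growth_const * K" using growth_const_pos K by simp
    fix x \<delta> assume x: "x \<in> E" and \<delta>: "(0::real) < \<delta>"
    have "x \<in> interior C" using x E by blast
    then obtain e where e: "0 < e" "ball x e \<subseteq> C" by (meson mem_interior)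
    \<comment> \<open>The bound \<open>e / 10\<close> keeps the tenfold ball in \<open>C\<close>; \<open>\<delta> / K\<close> gives the estimate of the Lebesgue measure.\<close>
    have "0 < min (min \<delta> 1) (min (e / 10) (\<delta> / K))" using \<delta> K e by simp
    from large[OF x this] obtain \<rho> where \<rho>: "0 < \<rho>" "\<rho> < min (min \<delta> 1) (min (e / 10) (\<delta> / K))"
      and Q: "\<theta> < inverse (H_minus a p q (ball x \<rho>) (1 / \<rho>)) *
        (1 / measure lebesgue (ball x \<rho>) * (LINT x:ball x \<rho>|lebesgue. H a p q x (g x)))" by blast
    have \<rho>': "\<rho> < \<delta>" "\<rho> \<le> 1" "10 * \<rho> \<le> e" "\<rho> \<le> \<delta> / K" using \<rho> by auto
    let ?B = "ball x \<rho>"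
    let ?h = "H_minus a p q ?B (1 / \<rho>)" and ?m = "measure lebesgue ?B"
    let ?I = "LINT x:?B|lebesgue. \<Phi> x (g x)"
    have sub: "ball x (10 * \<rho>) \<subseteq> C" using \<rho>' by (intro order_trans[OF _ e(2)] subset_ball)
    have B: "?B \<subseteq> C" using \<rho> by (intro order_trans[OF _ sub] subset_ball) auto
    have hp: "(1 / \<rho>) powr p \<le> ?h" using \<rho>(1) B C by (intro H_minus_lower) auto
    then have h: "0 < ?h" using \<rho>(1) less_le_trans[of 0 "(1 / \<rho>) powr p" ?h] by simp
    have m: "0 < ?m" using \<rho>(1) by simp
    have "(\<theta> * ?h / 2) powr s * ?m \<le> ?I"
    proof (rule powr_mean_lower_bound)
      show "set_integrable lebesgue ?B (\<lambda>x. H a p q x (g x))"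
        "set_integrable lebesgue ?B (\<lambda>x. \<Phi> x (g x))"
        using G Gs B by (auto intro: set_integrable_subset)
      show "0 \<le> H a p q y (g y)" if "y \<in> ?B" for y using that B C by (intro H_nonneg) auto
      show "2 * (\<theta> * ?h / 2) * ?m \<le> (LINT x:?B|lebesgue. H a p q x (g x))"
        using Q h m by (simp add: field_simps)
    qed (use exps \<theta> h in auto)
    moreover have "(\<theta> * ?h / 2) powr s = ?h powr s / K"
      using \<theta> h by (simp add: K_def powr_divide powr_mult field_simps)
    ultimately have main: "?h powr s * ?m \<le> K * ?I" using K by (simp add: field_simps)
    have emB: "emeasure \<nu> ?B = ennreal ?I" by (rule em[OF _ B]) auto
    have I: "0 \<le> ?I" unfolding set_lebesgue_integral_def by (intro integral_nonneg_AE) auto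
    have "doubled_gauge \<Phi> (x, 5 * \<rho>) \<le> ennreal (growth_const * (?h powr s * ?m))"
      using \<rho>(1) \<rho>' sub C by (intro doubled_gauge_le) auto
    also have "\<dots> \<le> ennreal (growth_const * (K * ?I))"
      using main growth_const_pos by (intro ennreal_leI mult_left_mono) auto
    also have "\<dots> = ennreal (growth_const * K) * emeasure \<nu> ?B"
      unfolding emB using growth_const_pos K I by (simp add: mult.assoc flip: ennreal_mult)
    finally have 1: "doubled_gauge \<Phi> (x, 5 * \<rho>) \<le> ennreal (growth_const * K) * emeasure \<nu> ?B" .
    \<comment> \<open>The exponent \<open>p s\<close> is larger than \<open>1\<close>, so the first power of \<open>1 / \<rho>\<close> is enough to beat \<open>\<delta>\<close>.\<close>
    have "1 / \<rho> \<le> ?h powr s"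
    proof -
      have "(1 / \<rho>) powr 1 \<le> (1 / \<rho>) powr (p * s)"
        using \<rho>(1) \<rho>'(2) exps mult_mono[of 1 p 1 s] by (intro powr_mono) auto
      also have "\<dots> = ((1 / \<rho>) powr p) powr s" by (simp add: powr_powr)
      also have "\<dots> \<le> ?h powr s" using hp exps by (intro powr_mono2) auto
      finally show ?thesis using \<rho>(1) by simp
    qed
    then have "1 / \<rho> * ?m \<le> K * ?I"
      using m mult_right_mono[of "1 / \<rho>" "?h powr s" ?m] main by linarith
    then have "?m \<le> \<rho> * K * ?I" using \<rho>(1) by (simp add: field_simps)
    also have "\<dots> \<le> \<delta> * ?I" using \<rho>'(4) K I by (intro mult_right_mono) (auto simp: field_simps)
    finally have "emeasure lebesgue ?B \<le> ennreal \<delta> * emeasure \<nu> ?B"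
      unfolding emB using \<delta> I
      by (simp add: emeasure_eq_measure2 fmeasurableD ennreal_leI flip: ennreal_mult)
    with 1 \<rho>(1) \<rho>'(1) show "\<exists>\<rho>>0. \<rho> < \<delta> \<and>
        doubled_gauge \<Phi> (x, 5 * \<rho>) \<le> ennreal (growth_const * K) * emeasure \<nu> (ball x \<rho>) \<and>
        emeasure lebesgue (ball x \<rho>) \<le> ennreal \<delta> * emeasure \<nu> (ball x \<rho>)" by blast
  qed
qed

text \<open>A positive upper limit exceeds some \<open>1 / (k + 1)\<close>, and a point of \<open>\<Omega>\<close> lies in some member of
  a compact exhaustion; on each of the countably many pieces so obtained \<open>gauge_null_large_means\<close>
  applies.\<close>

theorem gauge_null_Limsup_means:
  fixes g :: "'a \<Rightarrow> real"
  assumes G: "L1_loc \<Omega> (\<lambda>x. H a p q x (g x))" and Gs: "L1_loc \<Omega> (\<lambda>x. \<Phi> x (g x))"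
  shows "gauge_null \<Omega> (doubled_gauge \<Phi>) {x0\<in>\<Omega>. Limsup (at_right 0) (\<lambda>\<rho>. ereal (
        inverse (H_minus a p q (ball x0 \<rho>) (1 / \<rho>)) *
        (1 / measure lebesgue (ball x0 \<rho>) * (LINT x:ball x0 \<rho>|lebesgue. H a p q x (g x))))) > 0}"
    (is "gauge_null _ _ ?S")
proof -
  define Q where "Q x0 \<rho> = inverse (H_minus a p q (ball x0 \<rho>) (1 / \<rho>)) *
     (1 / measure lebesgue (ball x0 \<rho>) * (LINT x:ball x0 \<rho>|lebesgue. H a p q x (g x)))" for x0 \<rho>
  obtain C :: "nat \<Rightarrow> 'a set" where C: "\<And>n. compact (C n)" "\<And>n. C n \<subseteq> \<Omega>"
    "\<And>n. C n \<subseteq> interior (C (Suc n))" "\<Union>(range C) = \<Omega>"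
    using open_Union_compact_subsets[OF open_\<Omega>] by metis
  define E where "E k m = {x\<in>interior (C m). \<forall>\<delta>>0. \<exists>\<rho>. 0 < \<rho> \<and> \<rho> < \<delta> \<and> 1 / real (Suc k) < Q x \<rho>}"
    for k m :: nat
  have "gauge_null \<Omega> (doubled_gauge \<Phi>) (E k m)" for k m
  proof (rule gauge_null_large_means[where C = "C m" and \<theta> = "1 / real (Suc k)" and g = g])
    show "set_integrable lebesgue (C m) (\<lambda>x. H a p q x (g x))"
      "set_integrable lebesgue (C m) (\<lambda>x. \<Phi> x (g x))"
      using G Gs C by (auto simp: L1_loc_def)
  qed (use C in \<open>auto simp: E_def Q_def\<close>)
  then have "gauge_null \<Omega> (doubled_gauge \<Phi>) (\<Union>k. \<Union>m. E k m)" by (intro gauge_null_UN)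
  moreover have "?S \<subseteq> (\<Union>k. \<Union>m. E k m)"
  proof
    fix x assume x: "x \<in> ?S"
    then obtain n where "x \<in> C n" using C(4) by blast
    then have "x \<in> interior (C (Suc n))" using C(3) by blast
    moreover obtain k where "\<And>\<delta>. 0 < \<delta> \<Longrightarrow> \<exists>\<rho>. 0 < \<rho> \<and> \<rho> < \<delta> \<and> 1 / real (Suc k) < Q x \<rho>"
      using x Limsup_at_right_0_pos[of "Q x"] by (auto simp: Q_def)
    ultimately have "x \<in> E k (Suc n)" by (simp add: E_def)
    then show "x \<in> (\<Union>k. \<Union>m. E k m)" by blast
  qed
  ultimately show ?thesis
    by (rule gauge_null_compare[OF _ _ zero_less_one zero_less_one]) auto
qed

end

section \<open>Hausdorff measures\<close>

lemma ball_subset_of_double: "0 < r \<Longrightarrow> cball c (2 * r) \<subseteq> \<Omega> \<Longrightarrow> ball c r \<subseteq> \<Omega>"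
  by (erule order_trans[rotated]) auto

lemma tendsto_Lim_at_right_0_eq:
  fixes f :: "real \<Rightarrow> ennreal"
  assumes "\<And>\<kappa>. 0 < \<kappa> \<Longrightarrow> f \<kappa> = c"
  shows "Lim (at_right 0) f = c"
proof (rule tendsto_Lim)
  have "\<forall>\<^sub>F \<kappa> in at_right 0. f \<kappa> = c"
    using assms by (auto simp: eventually_at_right_field intro: exI[of _ 1])
  then show "(f \<longlongrightarrow> c) (at_right 0)" by (rule tendsto_eventually)
qed simp

lemma weighted_hausdorff_eq_0:
  assumes E: "gauge_null \<Omega> (h_gauge \<Phi>) E"
  shows "weighted_hausdorff \<Omega> \<Phi> E = 0"
  unfolding weighted_hausdorff_def
proof (rule tendsto_Lim_at_right_0_eq)
  fix \<kappa> :: real assume \<kappa>: "0 < \<kappa>"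
  have le: "weighted_hausdorff_pre \<Omega> \<Phi> \<kappa> E \<le> 0 + ennreal \<epsilon>" if "0 < \<epsilon>" for \<epsilon>
  proof -
    obtain C where C: "countable C"
      "\<forall>(c, r)\<in>C. 0 < r \<and> r \<le> \<kappa> \<and> cball c (2 * r) \<subseteq> \<Omega>" "E \<subseteq> (\<Union>(c, r)\<in>C. ball c r)"
      "\<forall>F. finite F \<longrightarrow> F \<subseteq> C \<longrightarrow> sum (h_gauge \<Phi>) F \<le> ennreal \<epsilon>"
      using E \<kappa> \<open>0 < \<epsilon>\<close> unfolding gauge_null_def by meson
    have "ball c r \<subseteq> \<Omega>" if "(c, r) \<in> C" for c r
      by (rule ball_subset_of_double[of r]) (use that C(2) in auto)
    then have "C \<in> ball_covers \<Omega> \<kappa> E" using C(1-3) by (auto simp: ball_covers_def)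
    then have "weighted_hausdorff_pre \<Omega> \<Phi> \<kappa> E \<le> infsum (h_gauge \<Phi>) C"
      unfolding weighted_hausdorff_pre_def by (rule INF_lower)
    also have "\<dots> \<le> ennreal \<epsilon>" using C(4) by (intro infsum_ennreal_le) auto
    finally show ?thesis by simp
  qed
  have "weighted_hausdorff_pre \<Omega> \<Phi> \<kappa> E \<le> 0" by (rule ennreal_le_epsilon) (rule le)
  then show "weighted_hausdorff_pre \<Omega> \<Phi> \<kappa> E = 0" by simp
qed

lemma hausdorff_measure_eq_0:
  assumes E: "gauge_null \<Omega> (\<lambda>(c, r). hausdorff_gauge d (ball c r)) E"
  shows "hausdorff_measure d E = 0"
  unfolding hausdorff_measure_def
proof (rule tendsto_Lim_at_right_0_eq)
  fix \<kappa> :: real assume \<kappa>: "0 < \<kappa>"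
  have le: "hausdorff_pre d \<kappa> E \<le> 0 + ennreal \<epsilon>" if "0 < \<epsilon>" for \<epsilon>
  proof -
    have "0 < \<kappa> / 2" using \<kappa> by simp
    then obtain C where C: "countable C"
      "\<forall>(c, r)\<in>C. 0 < r \<and> r \<le> \<kappa> / 2 \<and> cball c (2 * r) \<subseteq> \<Omega>" "E \<subseteq> (\<Union>(c, r)\<in>C. ball c r)"
      "\<forall>F. finite F \<longrightarrow> F \<subseteq> C \<longrightarrow> sum (\<lambda>(c, r). hausdorff_gauge d (ball c r)) F \<le> ennreal \<epsilon>"
      using E \<open>0 < \<epsilon>\<close> unfolding gauge_null_def by meson
    define U where "U = (\<lambda>(c, r). ball c r) ` C"
    have "countable U \<and> (\<forall>B\<in>U. bounded B \<and> diameter B \<le> \<kappa>) \<and> E \<subseteq> \<Union>U"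
    proof (intro conjI ballI)
      fix B assume "B \<in> U"
      then obtain c r where B: "B = ball c r" "(c, r) \<in> C" by (auto simp: U_def)
      then have "0 < r" "r \<le> \<kappa> / 2" using C(2) by auto
      then show "bounded B" "diameter B \<le> \<kappa>" unfolding B by auto
    qed (use C(1,3) in \<open>auto simp: U_def\<close>)
    then have "hausdorff_pre d \<kappa> E \<le> infsum (hausdorff_gauge d) U"
      unfolding hausdorff_pre_def by (intro INF_lower) auto
    also have "\<dots> \<le> ennreal \<epsilon>"
    proof (rule infsum_ennreal_le)
      fix F assume F: "finite F" "F \<subseteq> U"
      then obtain F' where F': "F' \<subseteq> C" "finite F'" "F = (\<lambda>(c, r). ball c r) ` F'"
        unfolding U_def by (meson finite_subset_image)
      have "sum (hausdorff_gauge d) F \<le> sum (hausdorff_gauge d \<circ> (\<lambda>(c, r). ball c r)) F'"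
        unfolding F' using F'(2) by (intro sum_image_le) auto
      also have "\<dots> = sum (\<lambda>(c, r). hausdorff_gauge d (ball c r)) F'"
        by (intro sum.cong) auto
      also have "\<dots> \<le> ennreal \<epsilon>" using C(4) F' by blast
      finally show "sum (hausdorff_gauge d) F \<le> ennreal \<epsilon>" .
    qed
    finally show ?thesis by simp
  qed
  have "hausdorff_pre d \<kappa> E \<le> 0" by (rule ennreal_le_epsilon) (rule le)
  then show "hausdorff_pre d \<kappa> E = 0" by simp
qed

lemma h_gauge_le_doubled_gauge:
  assumes "0 < r"
  shows "h_gauge \<Phi> (c, r) \<le> doubled_gauge \<Phi> (c, r)"
  unfolding h_gauge_def doubled_gauge_def using assms
  by (auto intro!: nn_integral_mono split: split_indicator)

text \<open>A lower bound \<open>\<Phi>(x, 1/r) \<ge> k r\<^sup>-\<^sup>e\<close> turns the weighted gauge of a ball into a multiple of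
  \<open>r\<^sup>n\<^sup>-\<^sup>e\<close>. For \<open>n = e\<close> the ball has gauge \<open>1\<close> and the weighted gauge is bounded below; the
  summand \<open>1\<close> in the constant covers this case.\<close>

lemma hausdorff_gauge_le_doubled_gauge:
  fixes c :: "'a::euclidean_space"
  assumes r: "0 < r" and k: "0 < k" and d: "0 \<le> d" "d = real DIM('a) - e"
    and lower: "\<And>x. x \<in> ball c r \<Longrightarrow> k * (1 / r) powr e \<le> \<Phi> x (1 / r)"
  shows "hausdorff_gauge d (ball c r)
    \<le> ennreal ((1 + unit_ball_vol d) / (unit_ball_vol (real DIM('a)) * k)) * doubled_gauge \<Phi> (c, r)"
proof -
  let ?v = "unit_ball_vol (real DIM('a))"
  have v: "0 < ?v" by (intro unit_ball_vol_pos) auto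
  have vd: "0 \<le> unit_ball_vol d" using d by (intro unit_ball_vol_nonneg) auto
  have "hausdorff_gauge d (ball c r) \<le> ennreal ((1 + unit_ball_vol d) * r powr d)"
  proof (cases "d = 0")
    case True
    have "1 \<le> ennreal (1 + unit_ball_vol d)" using vd by (subst ennreal_1[symmetric]) (intro ennreal_leI, simp)
    with True r show ?thesis by (simp add: hausdorff_gauge_def)
  next
    case False
    then show ?thesis
      using r vd by (auto simp: hausdorff_gauge_def intro!: ennreal_leI mult_right_mono)
  qed
  also have "(1 + unit_ball_vol d) * r powr d
      = (1 + unit_ball_vol d) / (?v * k) * (k * (1 / r) powr e * (?v * r ^ DIM('a)))"
    using r less_imp_neq[OF v] k by (simp add: d powr_diff powr_divide powr_realpow)
  also have "ennreal \<dots> = ennreal ((1 + unit_ball_vol d) / (?v * k)) * ennreal (k * (1 / r) powr e * (?v * r ^ DIM('a)))"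
    using r v k vd by (intro ennreal_mult) auto
  also have "\<dots> \<le> ennreal ((1 + unit_ball_vol d) / (?v * k)) * doubled_gauge \<Phi> (c, r)"
  proof (rule mult_left_mono)
    have "ennreal (k * (1 / r) powr e * (?v * r ^ DIM('a)))
        = ennreal (k * (1 / r) powr e) * emeasure lebesgue (ball c r)"
      using r k v by (simp add: emeasure_ball ennreal_mult flip: ennreal_mult)
    also have "\<dots> = (\<integral>\<^sup>+x\<in>ball c r. ennreal (k * (1 / r) powr e) \<partial>lebesgue)"
      by (simp add: nn_integral_cmult_indicator)
    also have "\<dots> \<le> h_gauge \<Phi> (c, r)"
      unfolding h_gauge_def using lower
      by (auto intro!: nn_integral_mono ennreal_leI split: split_indicator)
    also have "\<dots> \<le> doubled_gauge \<Phi> (c, r)" using r by (rule h_gauge_le_doubled_gauge)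
    finally show "ennreal (k * (1 / r) powr e * (?v * r ^ DIM('a))) \<le> doubled_gauge \<Phi> (c, r)" .
  qed simp
  finally show ?thesis .
qed

context double_phase_coeff
begin

lemma weighted_hausdorff_of_gauge_null:
  assumes "gauge_null \<Omega> (doubled_gauge \<Phi>) E"
  shows "weighted_hausdorff \<Omega> \<Phi> E = 0"
  by (rule weighted_hausdorff_eq_0)
    (rule gauge_null_compare[OF assms order_refl zero_less_one zero_less_one],
      simp add: h_gauge_le_doubled_gauge)

lemma gauge_constant_pos:
  assumes "0 \<le> d" "0 < k"
  shows "0 < (1 + unit_ball_vol d) / (unit_ball_vol (real DIM('a)) * k)"
  using assms by (intro divide_pos_pos mult_pos_pos unit_ball_vol_pos add_pos_nonneg unit_ball_vol_nonneg) auto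

lemma hausdorff_measure_of_gauge_null:
  assumes E: "gauge_null \<Omega> (doubled_gauge \<Phi>) E" and d: "0 \<le> real DIM('a) - p * s"
  shows "hausdorff_measure (real DIM('a) - p * s) E = 0"
proof (rule hausdorff_measure_eq_0)
  let ?d = "real DIM('a) - p * s"
  show "gauge_null \<Omega> (\<lambda>(c, r). hausdorff_gauge ?d (ball c r)) E"
  proof (rule gauge_null_compare[OF E order_refl zero_less_one gauge_constant_pos[OF d zero_less_one]])
    fix c r assume r: "0 < r" and sub: "cball c (2 * r) \<subseteq> \<Omega>"
    have "1 * (1 / r) powr (p * s) \<le> \<Phi> x (1 / r)" if "x \<in> ball c r" for x
    proof -
      have "ball c r \<subseteq> cball c (2 * r)" using r by auto
      then have "x \<in> \<Omega>" using that sub by blast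
      then have "((1 / r) powr p) powr s \<le> \<Phi> x (1 / r)"
        using a_nonneg exps by (intro powr_mono2) (auto simp: H_def)
      then show ?thesis by (simp add: powr_powr)
    qed
    from hausdorff_gauge_le_doubled_gauge[where \<Phi> = \<Phi>, OF r zero_less_one d refl this]
    show "(case (c, r) of (c, r) \<Rightarrow> hausdorff_gauge ?d (ball c r))
        \<le> ennreal ((1 + unit_ball_vol ?d) / (unit_ball_vol (real DIM('a)) * 1)) * doubled_gauge \<Phi> (c, r)"
      by simp
  qed
qed

text \<open>Near a point with \<open>a > 1 / (k + 1)\<close> the coefficient stays above half of this value on all
  small balls, so there the term with exponent \<open>q\<close> bounds the gauge from below. For \<open>n = q s\<close> this
  says that the set is empty.\<close>

lemma hausdorff_measure_of_gauge_null_pos: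
  assumes E: "gauge_null \<Omega> (doubled_gauge \<Phi>) E" and d: "0 \<le> real DIM('a) - q * s"
    and "E \<subseteq> \<Omega>"
  shows "hausdorff_measure (real DIM('a) - q * s) (E \<inter> {x\<in>\<Omega>. a x > 0}) = 0"
proof (rule hausdorff_measure_eq_0)
  let ?d = "real DIM('a) - q * s"
  let ?T = "\<lambda>(c, r). hausdorff_gauge ?d (ball c r)"
  define E' where "E' k = {x\<in>E. 1 / real (Suc k) < a x}" for k
  have null: "gauge_null \<Omega> ?T (E' k)" for k
  proof -
    define \<tau> where "\<tau> = 1 / (2 * real (Suc k))"
    \<comment> \<open>Balls of radius at most \<open>\<kappa>\<close> have diameter at most \<open>2 \<kappa>\<close>, on which \<open>a\<close> varies by at most \<open>\<tau>\<close>.\<close>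
    define \<kappa> where "\<kappa> = (\<tau> / (A + 1)) powr (1 / \<alpha>) / 2"
    have \<tau>: "0 < \<tau>" by (simp add: \<tau>_def)
    have \<tau>2: "2 * \<tau> = 1 / real (Suc k)" by (simp add: \<tau>_def field_simps)
    have \<kappa>: "0 < \<kappa>" using \<tau> A by (simp add: \<kappa>_def)
    have \<kappa>': "A * (2 * \<kappa>) powr \<alpha> \<le> \<tau>"
      using \<tau> A exps by (simp add: \<kappa>_def powr_powr field_simps)
    have "0 < \<tau> powr s" using \<tau> by simp
    show ?thesis
    proof (rule gauge_null_compare[OF E _ \<kappa> gauge_constant_pos[OF d \<open>0 < \<tau> powr s\<close>]])
      show "E' k \<subseteq> E" by (auto simp: E'_def)
      fix c r assume r: "0 < r" "r \<le> \<kappa>" and sub: "cball c (2 * r) \<subseteq> \<Omega>" and ne: "ball c r \<inter> E' k \<noteq> {}"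
      obtain z where z: "z \<in> ball c r" "z \<in> E" "2 * \<tau> < a z" using ne by (auto simp: E'_def \<tau>2)
      have "\<tau> powr s * (1 / r) powr (q * s) \<le> \<Phi> x (1 / r)" if x: "x \<in> ball c r" for x
      proof -
        have "ball c r \<subseteq> cball c (2 * r)" using r by auto
        then have xz: "x \<in> \<Omega>" "z \<in> \<Omega>" using x z sub by blast+
        have "dist z x \<le> dist c z + dist c x" by (metis dist_commute dist_triangle)
        also have "\<dots> \<le> 2 * \<kappa>" using x z r by simp
        finally have "A * dist z x powr \<alpha> \<le> A * (2 * \<kappa>) powr \<alpha>"
          using A exps by (intro mult_left_mono powr_mono2) auto
        with a_holder[OF xz(2,1)] \<kappa>' z(3) have "\<tau> \<le> a x" by linarith
        then have "\<tau> * (1 / r) powr q \<le> H a p q x (1 / r)"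
          unfolding H_def by (intro add_increasing mult_right_mono) auto
        then have "(\<tau> * (1 / r) powr q) powr s \<le> \<Phi> x (1 / r)"
          using \<tau> exps by (intro powr_mono2) auto
        then show ?thesis using \<tau> by (simp add: powr_powr powr_mult)
      qed
      from hausdorff_gauge_le_doubled_gauge[where \<Phi> = \<Phi>, OF r(1) \<open>0 < \<tau> powr s\<close> d refl this]
      show "?T (c, r) \<le> ennreal ((1 + unit_ball_vol ?d) /
          (unit_ball_vol (real DIM('a)) * \<tau> powr s)) * doubled_gauge \<Phi> (c, r)"
        by simp
    qed
  qed
  have "gauge_null \<Omega> ?T (\<Union>k. E' k)" by (rule gauge_null_UN) (rule null)
  moreover have "E \<inter> {x\<in>\<Omega>. a x > 0} \<subseteq> (\<Union>k. E' k)"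
  proof
    fix x assume "x \<in> E \<inter> {x\<in>\<Omega>. a x > 0}"
    then show "x \<in> (\<Union>k. E' k)"
      using reals_Archimedean[of "a x"] by (auto simp: E'_def inverse_eq_divide)
  qed
  ultimately show "gauge_null \<Omega> ?T (E \<inter> {x\<in>\<Omega>. a x > 0})"
    by (rule gauge_null_compare[OF _ _ zero_less_one zero_less_one]) auto
qed

end

section \<open>Smooth test functions\<close>

lemma has_derivative_frechet:
  "f differentiable (at x) \<Longrightarrow> (f has_derivative frechet_derivative f (at x)) (at x)"
  by (simp add: frechet_derivative_works)

lemma frechet_derivative_eqI:
  "(f has_derivative f') (at x) \<Longrightarrow> frechet_derivative f (at x) = f'"
  by (rule frechet_derivative_at[symmetric])

lemma Ck_SucI:
  assumes "\<And>x. (f has_derivative f' x) (at x)" and "\<And>b. b \<in> Basis \<Longrightarrow> Ck k (\<lambda>x. f' x b)"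
  shows "Ck (Suc k) f"
  using assms by (auto simp: differentiable_def frechet_derivative_eqI[OF assms(1)])

lemma Ck_Suc_D: "Ck (Suc k) f \<Longrightarrow> Ck k f"
proof (induction k arbitrary: f)
  case 0
  then show ?case by (auto intro!: continuous_at_imp_continuous_on differentiable_imp_continuous_within)
next
  case (Suc k)
  then show ?case unfolding Ck.simps(2)[of "Suc k"] Ck.simps(2)[of k] by blast
qed

lemma Ck_const: "Ck k (\<lambda>x. c)"
  by (induction k arbitrary: c) (auto intro!: Ck_SucI[where f' = "\<lambda>_ _. 0"] simp del: Ck.simps(2))

lemma Ck_add: "Ck k f \<Longrightarrow> Ck k g \<Longrightarrow> Ck k (\<lambda>x. f x + g x)"
proof (induction k arbitrary: f g)
  case (Suc k)
  then have "f differentiable (at x)" "g differentiable (at x)" for x by auto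
  then show ?case
    using Suc by (intro Ck_SucI[where f' = "\<lambda>x b. frechet_derivative f (at x) b + frechet_derivative g (at x) b"])
      (auto intro!: has_derivative_add has_derivative_frechet)
qed (auto intro: continuous_on_add)

lemma Ck_mult: "Ck k f \<Longrightarrow> Ck k g \<Longrightarrow> Ck k (\<lambda>x. f x * g x)"
proof (induction k arbitrary: f g)
  case (Suc k)
  then have d: "f differentiable (at x)" "g differentiable (at x)" for x by auto
  show ?case
  proof (rule Ck_SucI)
    show "((\<lambda>x. f x * g x) has_derivative
        (\<lambda>b. f x * frechet_derivative g (at x) b + frechet_derivative f (at x) b * g x)) (at x)" for x
      using d by (intro has_derivative_mult has_derivative_frechet)
    show "Ck k (\<lambda>x. f x * frechet_derivative g (at x) b + frechet_derivative f (at x) b * g x)"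
      if "b \<in> Basis" for b
      using Suc.prems that by (intro Ck_add Suc.IH Ck_Suc_D[OF Suc.prems(1)] Ck_Suc_D[OF Suc.prems(2)]) auto
  qed
qed (auto intro: continuous_on_mult)

lemma Ck_prod: "finite I \<Longrightarrow> (\<And>i. i \<in> I \<Longrightarrow> Ck k (f i)) \<Longrightarrow> Ck k (\<lambda>x. \<Prod>i\<in>I. f i x)"
  by (induction I rule: finite_induct) (auto intro: Ck_const Ck_mult)

text \<open>The functions \<open>P(1/x) exp (-1/x)\<close>, extended by zero to the left. The family is closed under
  differentiation, which gives smoothness of \<open>exp (-1/x)\<close> by induction over the order with \<open>P\<close>
  arbitrary.\<close>

definition flat :: "real poly \<Rightarrow> real \<Rightarrow> real" where
  "flat P x = (if 0 < x then poly P (1 / x) * exp (- 1 / x) else 0)"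

lemma flat_tendsto_0: "(flat P \<longlongrightarrow> 0) (at 0)"
proof -
  have "((\<lambda>t. poly P t * exp (- t)) \<longlongrightarrow> (\<Sum>i\<le>degree P. coeff P i * 0)) at_top"
    unfolding poly_altdef sum_distrib_right
  proof (rule tendsto_sum)
    fix i
    have "((\<lambda>t. coeff P i * (t ^ i / exp t)) \<longlongrightarrow> coeff P i * 0) at_top"
      by (intro tendsto_mult tendsto_const tendsto_power_div_exp_0)
    then show "((\<lambda>t. coeff P i * t ^ i * exp (- t)) \<longlongrightarrow> coeff P i * 0) at_top"
      by (simp add: exp_minus field_simps)
  qed
  then have "((\<lambda>t. poly P t * exp (- t)) \<longlongrightarrow> 0) at_top" by simp
  from filterlim_compose[OF this filterlim_inverse_at_top_right]
  have "((\<lambda>x. poly P (inverse x) * exp (- inverse x)) \<longlongrightarrow> 0) (at_right 0)" .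
  then have "(flat P \<longlongrightarrow> 0) (at_right 0)"
    by (rule Lim_transform_eventually)
      (auto simp: flat_def eventually_at_right_field inverse_eq_divide intro!: exI[of _ 1])
  moreover have "(flat P \<longlongrightarrow> 0) (at_left 0)"
    by (rule tendsto_eventually) (auto simp: flat_def eventually_at_left_field intro!: exI[of _ "-1"])
  ultimately show ?thesis by (rule filterlim_split_at[rotated])
qed

lemma DERIV_flat:
  "(flat P has_real_derivative flat ([:0, 0, 1:] * (P - pderiv P)) x) (at x)"
proof (cases x "0::real" rule: linorder_cases)
  case less
  have "((\<lambda>x. 0) has_real_derivative 0) (at x)" by simp
  then have "(flat P has_real_derivative 0) (at x)"
    by (rule has_field_derivative_transform_within_open[where S = "{..<0}"])
      (use less in \<open>auto simp: flat_def\<close>)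
  then show ?thesis using less by (simp add: flat_def)
next
  case equal
  \<comment> \<open>The difference quotient at \<open>0\<close> is the member of the family with polynomial \<open>X P\<close>.\<close>
  have "((\<lambda>h. (flat P (0 + h) - flat P 0) / h) \<longlongrightarrow> 0) (at 0)"
  proof (rule Lim_transform_eventually[OF flat_tendsto_0[of "[:0, 1:] * P"]])
    show "\<forall>\<^sub>F h in at 0. flat ([:0, 1:] * P) h = (flat P (0 + h) - flat P 0) / h"
      by (intro always_eventually) (auto simp: flat_def)
  qed
  then show ?thesis using equal by (simp add: DERIV_def flat_def)
next
  case greater
  have "((\<lambda>x. poly P (1 / x) * exp (- 1 / x)) has_real_derivative
      flat ([:0, 0, 1:] * (P - pderiv P)) x) (at x)"
    using greater
    by (auto intro!: derivative_eq_intros simp: flat_def field_simps power2_eq_square)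
  then show ?thesis
    by (rule has_field_derivative_transform_within_open[where S = "{0<..}"])
      (use greater in \<open>auto simp: flat_def\<close>)
qed

lemma Ck_flat: "Ck k (\<lambda>x::'a::euclidean_space. flat P (c * (x \<bullet> b) + d))"
proof (induction k arbitrary: P)
  case 0
  have "continuous_on UNIV (flat P)" by (meson DERIV_flat DERIV_isCont continuous_at_imp_continuous_on)
  then have "continuous_on UNIV (flat P \<circ> (\<lambda>x::'a. c * (x \<bullet> b) + d))"
    by (intro continuous_on_compose continuous_intros) (auto intro: continuous_on_subset)
  then show ?case by (simp add: o_def)
next
  case (Suc k)
  show ?case
  proof (rule Ck_SucI)
    fix x :: 'a
    have "((\<lambda>x. c * (x \<bullet> b) + d) has_derivative (\<lambda>v. c * (v \<bullet> b))) (at x)"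
      by (auto intro!: derivative_eq_intros)
    from has_derivative_compose[OF this DERIV_flat[of P, unfolded has_field_derivative_def]]
    show "((\<lambda>x. flat P (c * (x \<bullet> b) + d)) has_derivative
        (\<lambda>v. flat ([:0, 0, 1:] * (P - pderiv P)) (c * (x \<bullet> b) + d) * (c * (v \<bullet> b)))) (at x)" .
  next
    fix b' :: 'a
    show "Ck k (\<lambda>x. flat ([:0, 0, 1:] * (P - pderiv P)) (c * (x \<bullet> b) + d) * (c * (b' \<bullet> b)))"
      by (intro Ck_mult Ck_const Suc)
  qed
qed

text \<open>For \<open>t > 0\<close> a smooth function that is positive exactly in \<open>box l u\<close>, and that increases to
  its indicator as \<open>t \<rightarrow> \<infinity>\<close>; the values \<open>exp (-1 / (t y))\<close> of a factor tend to \<open>1\<close> for \<open>y > 0\<close>.\<close>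

definition box_bump :: "'a::euclidean_space \<Rightarrow> 'a \<Rightarrow> real \<Rightarrow> 'a \<Rightarrow> real" where
  "box_bump l u t x = (\<Prod>b\<in>Basis. flat 1 (t * (x \<bullet> b) + - t * (l \<bullet> b)) * flat 1 (- t * (x \<bullet> b) + t * (u \<bullet> b)))"

lemma flat_1_bounds: "0 \<le> flat 1 x" "flat 1 x \<le> 1"
  by (auto simp: flat_def)

lemma box_bump_bounds: "0 \<le> box_bump l u t x" "box_bump l u t x \<le> 1"
  unfolding box_bump_def
  by (auto intro!: prod_nonneg prod_le_1 mult_nonneg_nonneg mult_le_one flat_1_bounds)

lemma box_bump_eq_0:
  assumes "0 < t" "x \<notin> box l u"
  shows "box_bump l u t x = 0"
proof -
  obtain b where b: "b \<in> Basis" "x \<bullet> b \<le> l \<bullet> b \<or> u \<bullet> b \<le> x \<bullet> b"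
    using assms(2) by (auto simp: mem_box not_less)
  have "flat 1 (t * (x \<bullet> b) + - t * (l \<bullet> b)) * flat 1 (- t * (x \<bullet> b) + t * (u \<bullet> b)) = 0"
    using b(2) assms(1) by (auto simp: flat_def)
  with b(1) show ?thesis unfolding box_bump_def by (intro prod_zero) auto
qed

lemma box_bump_tendsto:
  assumes "x \<in> box l u"
  shows "(\<lambda>n. box_bump l u (real (Suc n)) x) \<longlonglongrightarrow> 1"
proof -
  have flat: "(\<lambda>n. flat 1 (real (Suc n) * c)) \<longlonglongrightarrow> 1" if "0 < c" for c
  proof -
    have "(\<lambda>n. exp (- (1 / c) * (1 / real (Suc n)))) \<longlonglongrightarrow> exp (- (1 / c) * 0)"
      by (intro tendsto_intros LIMSEQ_Suc[OF lim_1_over_n])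
    moreover have "flat 1 (real (Suc n) * c) = exp (- (1 / c) * (1 / real (Suc n)))" for n
    proof -
      have "0 < real (Suc n) * c" using that by simp
      then show ?thesis by (simp add: flat_def mult.commute)
    qed
    ultimately show ?thesis by simp
  qed
  have "(\<lambda>n. box_bump l u (real (Suc n)) x) \<longlonglongrightarrow> (\<Prod>b\<in>(Basis::'a set). 1 * 1)"
    unfolding box_bump_def
  proof (intro tendsto_prod tendsto_mult)
    fix b :: 'a assume b: "b \<in> Basis"
    show "(\<lambda>n. flat 1 (real (Suc n) * (x \<bullet> b) + - real (Suc n) * (l \<bullet> b))) \<longlonglongrightarrow> 1"
      using flat[of "x \<bullet> b - l \<bullet> b"] b assms by (simp add: mem_box algebra_simps)
    show "(\<lambda>n. flat 1 (- real (Suc n) * (x \<bullet> b) + real (Suc n) * (u \<bullet> b))) \<longlonglongrightarrow> 1"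
      using flat[of "u \<bullet> b - x \<bullet> b"] b assms by (simp add: mem_box algebra_simps)
  qed
  then show ?thesis by simp
qed

lemma test_function_box_bump:
  assumes "cbox l u \<subseteq> \<Omega>" "0 < t"
  shows "test_function \<Omega> (box_bump l u t)"
  unfolding test_function_def
proof (intro conjI allI)
  show "Ck k (box_bump l u t)" for k
    unfolding box_bump_def[abs_def] by (intro Ck_prod Ck_mult Ck_flat) auto
  have "{x. box_bump l u t x \<noteq> 0} \<subseteq> cbox l u"
    using box_bump_eq_0[OF assms(2)] box_subset_cbox by blast
  then have sub: "closure {x. box_bump l u t x \<noteq> 0} \<subseteq> cbox l u"
    by (rule closure_minimal) (rule closed_cbox)
  moreover have "compact (closure {x. box_bump l u t x \<noteq> 0})"
    using sub bounded_subset[OF bounded_cbox sub] by (simp add: compact_eq_bounded_closed)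
  ultimately show "compact_support_in \<Omega> (box_bump l u t)"
    using assms(1) by (auto simp: compact_support_in_def)
qed

section \<open>Weak gradients\<close>

lemma test_function_continuous: "test_function \<Omega> \<phi> \<Longrightarrow> continuous_on UNIV \<phi>"
  by (metis Ck.simps(1) test_function_def)

lemma test_function_differentiable: "test_function \<Omega> \<phi> \<Longrightarrow> \<phi> differentiable (at x)"
  by (metis Ck.simps(2) test_function_def)

lemma test_function_continuous_derivative:
  "test_function \<Omega> \<phi> \<Longrightarrow> b \<in> Basis \<Longrightarrow> continuous_on UNIV (\<lambda>x. frechet_derivative \<phi> (at x) b)"
  by (metis Ck.simps test_function_def)

lemma L1_loc_mult_compact_support:
  assumes w: "L1_loc \<Omega> w" and \<phi>: "continuous_on UNIV \<phi>" "compact_support_in \<Omega> \<phi>"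
  shows "set_integrable lebesgue \<Omega> (\<lambda>x. w x * \<phi> x :: real)"
proof -
  define K where "K = closure {x. \<phi> x \<noteq> 0}"
  have K: "compact K" "K \<subseteq> \<Omega>" using \<phi> by (auto simp: K_def compact_support_in_def)
  have out: "\<phi> x = 0" if "x \<notin> K" for x using that closure_subset[of "{x. \<phi> x \<noteq> 0}"] unfolding K_def by blast
  have "(\<lambda>x. \<phi> x * w x) absolutely_integrable_on K"
  proof (rule absolutely_integrable_bounded_measurable_product[OF bilinear_times])
    show Kl: "K \<in> sets lebesgue" using K by (simp add: fmeasurableD lmeasurable_compact)
    have "continuous_on K \<phi>" using \<phi>(1) by (rule continuous_on_subset) simp
    then show "\<phi> \<in> borel_measurable (lebesgue_on K)" "bounded (\<phi> ` K)"
      using K Kl by (auto intro!: continuous_imp_measurable_on_sets_lebesgue compact_imp_bounded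
          compact_continuous_image)
    show "w absolutely_integrable_on K" using w K by (auto simp: L1_loc_def)
  qed
  moreover have "(\<lambda>x. indicator K x *\<^sub>R (\<phi> x * w x)) = (\<lambda>x. indicator \<Omega> x *\<^sub>R (w x * \<phi> x))"
    using K(2) out by (force split: split_indicator)
  ultimately show ?thesis by (simp only: set_integrable_def)
qed

text \<open>The fundamental lemma of the calculus of variations. Letting box bumps tend to indicators,
  the integral of \<open>w\<close> over every box in \<open>\<Omega>\<close> vanishes; at almost every point \<open>w\<close> is the limit of
  its means over small cubes, so it vanishes there.\<close>

lemma ae_zero_of_test_integrals:
  fixes w :: "'a::euclidean_space \<Rightarrow> real"
  assumes \<Omega>: "open \<Omega>" and w: "L1_loc \<Omega> w"
    and test: "\<And>\<phi>. test_function \<Omega> \<phi> \<Longrightarrow> (LINT x:\<Omega>|lebesgue. w x * \<phi> x) = 0"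
  shows "AE x in lebesgue. x \<in> \<Omega> \<longrightarrow> w x = 0"
proof -
  have box: "integral (cbox l u) w = 0" if sub: "cbox l u \<subseteq> \<Omega>" for l u
  proof -
    have int: "set_integrable lebesgue (cbox l u) w" using w sub by (auto simp: L1_loc_def)
    then have intb: "set_integrable lebesgue (box l u) w"
      by (rule set_integrable_subset) (auto simp: box_subset_cbox)
    let ?f = "\<lambda>n x. indicator \<Omega> x *\<^sub>R (w x * box_bump l u (real (Suc n)) x)"
    have "(\<lambda>n. integral\<^sup>L lebesgue (?f n)) \<longlonglongrightarrow> integral\<^sup>L lebesgue (\<lambda>x. indicator (box l u) x *\<^sub>R w x)"
    proof (rule integral_dominated_convergence[where w = "\<lambda>x. norm (indicator (cbox l u) x *\<^sub>R w x)"])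
      show "(\<lambda>x. indicator (box l u) x *\<^sub>R w x) \<in> borel_measurable lebesgue"
        using intb by (auto simp: set_integrable_def)
      show "integrable lebesgue (\<lambda>x. norm (indicator (cbox l u) x *\<^sub>R w x))"
        using int unfolding set_integrable_def by (rule integrable_norm)
      show "?f n \<in> borel_measurable lebesgue" for n
        using L1_loc_mult_compact_support[OF w, of "box_bump l u (real (Suc n))"]
          test_function_box_bump[OF sub, of "real (Suc n)"]
        by (auto simp: set_integrable_def test_function_continuous test_function_def)
      show "AE x in lebesgue. (\<lambda>n. ?f n x) \<longlonglongrightarrow> indicator (box l u) x *\<^sub>R w x"
      proof (rule AE_I2)
        fix x :: 'a
        show "(\<lambda>n. ?f n x) \<longlonglongrightarrow> indicator (box l u) x *\<^sub>R w x"
        proof (cases "x \<in> box l u")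
          case True
          then have "x \<in> \<Omega>" using sub box_subset_cbox by blast
          moreover have "(\<lambda>n. w x * box_bump l u (real (Suc n)) x) \<longlonglongrightarrow> w x * 1"
            by (intro tendsto_intros box_bump_tendsto True)
          ultimately show ?thesis using True by simp
        qed (simp add: box_bump_eq_0)
      qed
      show "AE x in lebesgue. norm (?f n x) \<le> norm (indicator (cbox l u) x *\<^sub>R w x)" for n
      proof (rule AE_I2)
        fix x :: 'a
        have "x \<notin> cbox l u \<Longrightarrow> box_bump l u (real (Suc n)) x = 0"
          using box_subset_cbox[of l u] by (intro box_bump_eq_0) auto
        then show "norm (?f n x) \<le> norm (indicator (cbox l u) x *\<^sub>R w x)"
          using box_bump_bounds[of l u "real (Suc n)" x] mult_left_le[of "box_bump l u (real (Suc n)) x" "\<bar>w x\<bar>"]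
          by (auto simp: abs_mult split: split_indicator)
      qed
    qed
    moreover have "integral\<^sup>L lebesgue (?f n) = 0" for n
      using test[OF test_function_box_bump[OF sub, of "real (Suc n)"]]
      by (simp add: set_lebesgue_integral_def)
    ultimately have "(\<lambda>n. 0) \<longlonglongrightarrow> (LINT x:box l u|lebesgue. w x)"
      by (simp only: set_lebesgue_integral_def)
    then have "(LINT x:box l u|lebesgue. w x) = 0" by (rule LIMSEQ_unique[OF _ tendsto_const])
    then show ?thesis
      using set_lebesgue_integral_eq_integral(2)[OF intb] by (simp add: integral_open_interval)
  qed
  obtain C :: "nat \<Rightarrow> 'a set" where C: "\<And>n. compact (C n)" "\<And>n. C n \<subseteq> \<Omega>"
    "\<And>n. C n \<subseteq> interior (C (Suc n))" "\<Union>(range C) = \<Omega>"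
    using open_Union_compact_subsets[OF \<Omega>] by metis
  have "\<exists>N. negligible N \<and> (\<forall>x\<in>interior (C m) - N. w x = 0)" for m
  proof -
    define f where "f x = (if x \<in> C m then w x else 0)" for x
    have "w absolutely_integrable_on C m" using w C by (auto simp: L1_loc_def)
    then have "f absolutely_integrable_on UNIV" by (simp add: f_def[abs_def] absolutely_integrable_restrict_UNIV)
    then have "f absolutely_integrable_on cbox l u" for l u
      by (rule set_integrable_subset) auto
    then have "f integrable_on cbox l u" for l u by (simp add: set_lebesgue_integral_eq_integral(1))
    then obtain N where N: "negligible N" "\<forall>x e. x \<notin> N \<longrightarrow> 0 < e \<longrightarrow>
      (\<exists>d>0. \<forall>h. 0 < h \<and> h < d \<longrightarrow> norm (integral (cbox x (x + h *\<^sub>R One)) f /\<^sub>R h ^ DIM('a) - f x) < e)"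
      by (rule integrable_ccontinuous_explicit) (rule that, assumption, blast)
    have "w x = 0" if x: "x \<in> interior (C m) - N" for x
    proof -
      obtain r where r: "0 < r" "ball x r \<subseteq> C m" using x by (meson DiffD1 mem_interior)
      have "norm (f x) < e" if e: "0 < e" for e
      proof -
        obtain d where d: "0 < d" "\<forall>h. 0 < h \<and> h < d \<longrightarrow>
            norm (integral (cbox x (x + h *\<^sub>R One)) f /\<^sub>R h ^ DIM('a) - f x) < e"
          using N(2) x e by blast
        define k where "k = r / DIM('a)"
        define h where "h = min d k / 2"
        have "0 < k" using r by (simp add: k_def)
        with d(1) have h: "0 < h" "h < d" "h < k" by (auto simp: h_def min_def)
        have sub: "cbox x (x + h *\<^sub>R One) \<subseteq> C m"
        proof
          fix y assume y: "y \<in> cbox x (x + h *\<^sub>R One)"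
          have "norm (y - x) \<le> (\<Sum>b\<in>Basis. \<bar>(y - x) \<bullet> b\<bar>)" by (rule norm_le_l1)
          also have "\<dots> \<le> (\<Sum>b\<in>(Basis::'a set). h)"
            using y by (intro sum_mono) (auto simp: mem_box inner_simps)
          also have "\<dots> < r" using h(3) by (simp add: k_def field_simps)
          finally have "y \<in> ball x r" by (simp add: dist_norm norm_minus_commute)
          then show "y \<in> C m" using r by blast
        qed
        then have "integral (cbox x (x + h *\<^sub>R One)) f = integral (cbox x (x + h *\<^sub>R One)) w"
          by (intro integral_cong) (auto simp: f_def)
        also have "\<dots> = 0" using sub C(2) by (intro box) blast
        finally show ?thesis using d(2) h by auto
      qed
      then have "f x = 0" by (metis less_irrefl norm_ge_zero norm_le_zero_iff not_less)
      then show "w x = 0" using x interior_subset by (auto simp: f_def split: if_splits)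
    qed
    with N(1) show ?thesis by blast
  qed
  then obtain N where N: "\<And>m. negligible (N m)" "\<And>m x. x \<in> interior (C m) - N m \<Longrightarrow> w x = 0" by metis
  have "negligible (\<Union>m. N m)" using N(1) by (intro negligible_countable_Union) auto
  then have "(\<Union>m. N m) \<in> null_sets lebesgue" by (simp add: negligible_iff_null_sets)
  moreover have "w x = 0" if x: "x \<in> \<Omega>" "x \<notin> (\<Union>m. N m)" for x
  proof -
    obtain m where "x \<in> C m" using x(1) C(4) by blast
    then have "x \<in> interior (C (Suc m))" using C(3) by blast
    then show ?thesis using N(2)[of x "Suc m"] x(2) by blast
  qed
  ultimately show ?thesis by (intro AE_I') auto
qed

text \<open>Needed because \<open>weak_gradient\<close> is an arbitrary representative: an estimate for the classical
  gradient must be transferred to it.\<close>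

lemma weak_gradient_unique:
  assumes \<Omega>: "open \<Omega>" and g: "has_weak_gradient \<Omega> f g" and g': "has_weak_gradient \<Omega> f g'"
  shows "AE x in lebesgue. x \<in> \<Omega> \<longrightarrow> g x = g' x"
proof -
  have loc: "L1_loc \<Omega> (\<lambda>x. h x \<bullet> b)" if "L1_loc \<Omega> h" for h :: "'a \<Rightarrow> 'a" and b
    using that by (auto simp: L1_loc_def intro: absolutely_integrable_component)
  have "AE x in lebesgue. x \<in> \<Omega> \<longrightarrow> g x \<bullet> b - g' x \<bullet> b = 0" if b: "b \<in> Basis" for b
  proof (rule ae_zero_of_test_integrals[OF \<Omega>])
    have l: "L1_loc \<Omega> (\<lambda>x. g x \<bullet> b)" "L1_loc \<Omega> (\<lambda>x. g' x \<bullet> b)"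
      using g g' by (auto simp: has_weak_gradient_def intro: loc)
    then show "L1_loc \<Omega> (\<lambda>x. g x \<bullet> b - g' x \<bullet> b)"
      by (auto simp: L1_loc_def intro: set_integral_diff)
    fix \<phi> assume \<phi>: "test_function \<Omega> \<phi>"
    then have c: "continuous_on UNIV \<phi>" "compact_support_in \<Omega> \<phi>"
      by (auto simp: test_function_continuous test_function_def)
    have "(LINT x:\<Omega>|lebesgue. (g x \<bullet> b - g' x \<bullet> b) * \<phi> x)
        = (LINT x:\<Omega>|lebesgue. (g x \<bullet> b) * \<phi> x) - (LINT x:\<Omega>|lebesgue. (g' x \<bullet> b) * \<phi> x)"
      using L1_loc_mult_compact_support[OF l(1) c] L1_loc_mult_compact_support[OF l(2) c]
      by (simp add: left_diff_distrib set_integral_diff)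
    also have "\<dots> = 0"
    proof -
      have "- (LINT x:\<Omega>|lebesgue. (g x \<bullet> b) * \<phi> x)
          = (LINT x:\<Omega>|lebesgue. f x * frechet_derivative \<phi> (at x) b)"
        using g \<phi> b unfolding has_weak_gradient_def by simp
      also have "\<dots> = - (LINT x:\<Omega>|lebesgue. (g' x \<bullet> b) * \<phi> x)"
        using g' \<phi> b unfolding has_weak_gradient_def by simp
      finally show ?thesis by simp
    qed
    finally show "(LINT x:\<Omega>|lebesgue. (g x \<bullet> b - g' x \<bullet> b) * \<phi> x) = 0" .
  qed
  then have "AE x in lebesgue. \<forall>b\<in>Basis. x \<in> \<Omega> \<longrightarrow> g x \<bullet> b - g' x \<bullet> b = 0"
    by (intro AE_finite_allI) auto
  then show ?thesis by eventually_elim (auto intro: euclidean_eqI)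
qed

lemma integrable_lborel_continuous_compact_support:
  fixes f :: "'a::euclidean_space \<Rightarrow> 'b::{banach, second_countable_topology}"
  assumes "continuous_on UNIV f" "compact K" "\<And>x. x \<notin> K \<Longrightarrow> f x = 0"
  shows "integrable lborel f"
proof -
  have "integrable lborel (\<lambda>x. indicator K x *\<^sub>R f x)"
    using assms by (intro borel_integrable_compact) (auto intro: continuous_on_subset)
  moreover have "(\<lambda>x. indicator K x *\<^sub>R f x) = f"
    using assms(3) by (force split: split_indicator)
  ultimately show ?thesis by simp
qed

text \<open>Integrals are translation invariant, so the difference quotients of \<open>w\<close> in direction \<open>b\<close>
  have integral zero; they are bounded and supported in a fixed compact set, so dominated
  convergence applies.\<close>

lemma integral_directional_derivative_eq_0:
  fixes w :: "'a::euclidean_space \<Rightarrow> real"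
  assumes der: "\<And>x. (w has_derivative w' x) (at x)" and cont: "continuous_on UNIV (\<lambda>x. w' x b)"
    and K: "compact K" and zero: "\<And>x. x \<notin> K \<Longrightarrow> w x = 0"
  shows "integral\<^sup>L lborel (\<lambda>x. w' x b) = 0"
proof -
  have w'0: "w' x b = 0" if "x \<notin> K" for x
  proof -
    have "((\<lambda>x. 0) has_derivative w' x) (at x)"
      by (rule has_derivative_transform_within_open[OF der, of "- K"])
        (use K that zero in \<open>auto simp: compact_imp_closed\<close>)
    then show ?thesis using has_derivative_unique[OF _ has_derivative_const] by metis
  qed
  have cw: "continuous_on UNIV w"
    using der by (meson has_derivative_continuous continuous_at_imp_continuous_on)
  then have mw: "w \<in> borel_measurable borel" by (rule borel_measurable_continuous_onI)
  have iw: "integrable lborel w" using cw K zero by (rule integrable_lborel_continuous_compact_support)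
  have "bounded ((\<lambda>x. w' x b) ` K)"
    using cont K by (intro compact_imp_bounded compact_continuous_image) (auto intro: continuous_on_subset)
  then obtain M where M: "0 < M" "\<And>x. x \<in> K \<Longrightarrow> \<bar>w' x b\<bar> \<le> M"
    by (auto simp: bounded_pos)
  have M': "\<bar>w' x b\<bar> \<le> M" for x using M w'0[of x] by (cases "x \<in> K") auto
  \<comment> \<open>\<open>K'\<close> contains the support of every difference quotient with step at most \<open>1\<close>.\<close>
  define K' where "K' = (\<lambda>(x, t). x - t *\<^sub>R b) ` (K \<times> {0..1::real})"
  have K': "compact K'"
    unfolding K'_def using K
    by (intro compact_continuous_image compact_Times) (auto simp: case_prod_beta intro!: continuous_intros)
  define h where "h n = 1 / real (Suc n)" for n
  have h: "0 < h n" "h n \<le> 1" for n by (auto simp: h_def)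
  define Q where "Q n x = (w (h n *\<^sub>R b + x) - w x) / h n" for n x
  have line: "((\<lambda>t. w (x + t *\<^sub>R b)) has_real_derivative w' (x + t *\<^sub>R b) b) (at t)" for x t
  proof -
    have "((\<lambda>t. x + t *\<^sub>R b) has_derivative (\<lambda>t. t *\<^sub>R b)) (at t)"
      by (auto intro!: derivative_eq_intros)
    from has_derivative_compose[OF this der]
    have "((\<lambda>t. w (x + t *\<^sub>R b)) has_derivative (\<lambda>s. w' (x + t *\<^sub>R b) (s *\<^sub>R b))) (at t)" .
    moreover have "w' y (s *\<^sub>R b) = w' y b * s" for y s
      using linear_cmul[OF has_derivative_linear[OF der]] by (simp add: mult.commute)
    ultimately show ?thesis by (simp add: has_field_derivative_def)
  qed
  have Qb: "\<bar>Q n x\<bar> \<le> indicator K' x * M" for n x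
  proof (cases "x \<in> K'")
    case True
    obtain z where z: "w (x + h n *\<^sub>R b) - w (x + 0 *\<^sub>R b) = (h n - 0) * w' (x + z *\<^sub>R b) b"
      using MVT2[OF h(1) line] by blast
    then have "Q n x = w' (x + z *\<^sub>R b) b" using h(1)[of n] by (simp add: Q_def add.commute)
    with M'[of "x + z *\<^sub>R b"] True show ?thesis by simp
  next
    case False
    have "w (x + t *\<^sub>R b) = 0" if "0 \<le> t" "t \<le> 1" for t
    proof (rule zero)
      show "x + t *\<^sub>R b \<notin> K"
      proof
        assume "x + t *\<^sub>R b \<in> K"
        then have "(\<lambda>(x, t). x - t *\<^sub>R b) (x + t *\<^sub>R b, t) \<in> K'"
          unfolding K'_def using that by (intro imageI) auto
        with False show False by simp
      qed
    qed
    from this[of 0] this[of "h n"] h[of n] M(1) show ?thesis by (simp add: Q_def add.commute)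
  qed
  have Qm: "Q n \<in> borel_measurable lborel" for n unfolding Q_def using mw by simp measurable
  have "(\<lambda>n. integral\<^sup>L lborel (Q n)) \<longlonglongrightarrow> integral\<^sup>L lborel (\<lambda>x. w' x b)"
  proof (rule integral_dominated_convergence[where w = "\<lambda>x. indicator K' x * M"])
    show "(\<lambda>x. w' x b) \<in> borel_measurable lborel"
      using borel_measurable_continuous_onI[OF cont] by simp
    show "Q n \<in> borel_measurable lborel" for n by (rule Qm)
    show "integrable lborel (\<lambda>x. indicator K' x * M)"
      using borel_integrable_compact[OF K' continuous_on_const[of _ M]] by simp
    show "AE x in lborel. norm (Q n x) \<le> indicator K' x * M" for n using Qb by simp
    show "AE x in lborel. (\<lambda>n. Q n x) \<longlonglongrightarrow> w' x b"
    proof (rule AE_I2)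
      fix x
      have "((\<lambda>s. (w (x + s *\<^sub>R b) - w x) / s) \<longlongrightarrow> w' x b) (at 0)"
        using line[of x 0] by (simp add: DERIV_def)
      moreover have "filterlim h (at 0) sequentially"
        unfolding filterlim_at
        using h LIMSEQ_Suc[OF lim_1_over_n] by (auto simp: h_def[abs_def] intro!: always_eventually)
      ultimately show "(\<lambda>n. Q n x) \<longlonglongrightarrow> w' x b"
        unfolding Q_def add.commute[of _ x] by (rule filterlim_compose)
    qed
  qed
  moreover have "integral\<^sup>L lborel (Q n) = 0" for n
  proof -
    let ?g = "\<lambda>x. w (h n *\<^sub>R b + x)"
    have "integrable (distr lborel borel ((+) (h n *\<^sub>R b))) w" using iw by (simp add: lborel_distr_plus)
    then have ig: "integrable lborel ?g" using mw by (subst (asm) integrable_distr_eq) auto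
    have "integral\<^sup>L lborel w = integral\<^sup>L (distr lborel borel ((+) (h n *\<^sub>R b))) w"
      by (simp add: lborel_distr_plus)
    also have "\<dots> = integral\<^sup>L lborel ?g" using mw by (subst integral_distr) auto
    finally show ?thesis using iw ig by (simp add: Q_def[abs_def])
  qed
  ultimately have "(\<lambda>n::nat. 0) \<longlonglongrightarrow> integral\<^sup>L lborel (\<lambda>x. w' x b)" by (simp only:)
  then show ?thesis by (rule LIMSEQ_unique[OF _ tendsto_const])
qed

lemma L1_loc_continuous:
  fixes f :: "'a::euclidean_space \<Rightarrow> 'b::euclidean_space"
  assumes "continuous_on UNIV f"
  shows "L1_loc \<Omega> f"
  unfolding L1_loc_def
proof (intro allI impI)
  fix K assume K: "compact K \<and> K \<subseteq> \<Omega>"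
  then have "integrable lborel (\<lambda>x. indicator K x *\<^sub>R f x)"
    using assms by (intro borel_integrable_compact) (auto intro: continuous_on_subset)
  then have "integrable lebesgue (\<lambda>x. indicator K x *\<^sub>R f x)"
    by (simp add: integrable_completion)
  then show "f absolutely_integrable_on K" by (simp add: set_integrable_def)
qed

lemma grad_inner:
  fixes f :: "'a::euclidean_space \<Rightarrow> real"
  assumes "b \<in> Basis"
  shows "grad f x \<bullet> b = frechet_derivative f (at x) b"
proof -
  have "grad f x \<bullet> b = (\<Sum>c\<in>Basis. frechet_derivative f (at x) c * (c \<bullet> b))"
    by (simp add: grad_def inner_sum_left)
  also have "\<dots> = frechet_derivative f (at x) b" using assms by (simp add: inner_Basis if_distrib cong: if_cong)
  finally show ?thesis .
qed

text \<open>Integration by parts: \<open>integral_directional_derivative_eq_0\<close> applied to the product with a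
  test function.\<close>

lemma has_weak_gradient_grad:
  fixes f :: "'a::euclidean_space \<Rightarrow> real"
  assumes f: "C1_on UNIV f" and supp: "compact_support_in \<Omega> f"
  shows "has_weak_gradient \<Omega> f (grad f)"
  unfolding has_weak_gradient_def
proof (intro conjI allI impI ballI)
  have df: "f differentiable (at x)" for x using f by (simp add: C1_on_def)
  have cf: "continuous_on UNIV f"
    by (meson df differentiable_imp_continuous_within continuous_at_imp_continuous_on)
  have cg: "continuous_on UNIV (grad f)" using f by (simp add: C1_on_def)
  show "L1_loc \<Omega> f" "L1_loc \<Omega> (grad f)" using cf cg by (auto intro: L1_loc_continuous)
  fix \<phi> b assume \<phi>: "test_function \<Omega> \<phi>" and b: "(b::'a) \<in> Basis"
  have dphi: "\<phi> differentiable (at x)" for x using \<phi> by (rule test_function_differentiable)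
  have cdphi: "continuous_on UNIV (\<lambda>x. frechet_derivative \<phi> (at x) b)" by (rule test_function_continuous_derivative[OF \<phi> b])
  have cphi: "continuous_on UNIV \<phi>" using \<phi> by (rule test_function_continuous)
  have cdf: "continuous_on UNIV (\<lambda>x. frechet_derivative f (at x) b)"
    using continuous_on_inner[OF cg continuous_on_const[of _ b]] b by (simp add: grad_inner)
  define Kf where "Kf = closure {x. f x \<noteq> 0}"
  define Kp where "Kp = closure {x. \<phi> x \<noteq> 0}"
  have K: "compact Kf" "Kf \<subseteq> \<Omega>" "compact Kp" "Kp \<subseteq> \<Omega>"
    using supp \<phi> by (auto simp: Kf_def Kp_def test_function_def compact_support_in_def)
  have f0: "f x = 0" if "x \<notin> Kf" for x
    using that closure_subset[of "{x. f x \<noteq> 0}"] unfolding Kf_def by blast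
  have phi0: "\<phi> x = 0" if "x \<notin> Kp" for x
    using that closure_subset[of "{x. \<phi> x \<noteq> 0}"] unfolding Kp_def by blast
  let ?A = "\<lambda>x. f x * frechet_derivative \<phi> (at x) b"
  let ?B = "\<lambda>x. frechet_derivative f (at x) b * \<phi> x"
  have cA: "continuous_on UNIV ?A" and cB: "continuous_on UNIV ?B"
    using cf cphi cdf cdphi by (auto intro: continuous_on_mult)
  have iA: "integrable lborel ?A"
    using cA K(1) by (rule integrable_lborel_continuous_compact_support) (simp add: f0)
  have iB: "integrable lborel ?B"
    using cB K(3) by (rule integrable_lborel_continuous_compact_support) (simp add: phi0)
  have "integral\<^sup>L lborel (\<lambda>x. ?A x + ?B x) = 0"
  proof (rule integral_directional_derivative_eq_0)
    show "((\<lambda>x. f x * \<phi> x) has_derivative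
        (\<lambda>b. f x * frechet_derivative \<phi> (at x) b + frechet_derivative f (at x) b * \<phi> x)) (at x)" for x
      using df dphi by (intro has_derivative_mult has_derivative_frechet)
    show "continuous_on UNIV (\<lambda>x. ?A x + ?B x)" using cA cB by (rule continuous_on_add)
    show "compact Kf" by (rule K)
    show "f x * \<phi> x = 0" if "x \<notin> Kf" for x using f0[OF that] by simp
  qed
  then have "integral\<^sup>L lborel ?A + integral\<^sup>L lborel ?B = 0" using iA iB by simp
  moreover have "(LINT x:\<Omega>|lebesgue. ?A x) = integral\<^sup>L lborel ?A"
  proof -
    have "(\<lambda>x. indicator \<Omega> x *\<^sub>R ?A x) = ?A"
      using f0 K(2) by (force split: split_indicator)
    then show ?thesis using borel_measurable_continuous_onI[OF cA]
      by (simp add: set_lebesgue_integral_def integral_completion)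
  qed
  moreover have "(LINT x:\<Omega>|lebesgue. ?B x) = integral\<^sup>L lborel ?B"
  proof -
    have "(\<lambda>x. indicator \<Omega> x *\<^sub>R ?B x) = ?B"
      using phi0 K(4) by (force split: split_indicator)
    then show ?thesis using borel_measurable_continuous_onI[OF cB]
      by (simp add: set_lebesgue_integral_def integral_completion)
  qed
  ultimately show "(LINT x:\<Omega>|lebesgue. f x * frechet_derivative \<phi> (at x) b)
      = - (LINT x:\<Omega>|lebesgue. (grad f x \<bullet> b) * \<phi> x)"
    using b by (simp add: grad_inner)
qed

theorem weak_gradient_eq_grad:
  fixes f :: "'a::euclidean_space \<Rightarrow> real"
  assumes \<Omega>: "open \<Omega>" and f: "C1_on UNIV f" and supp: "compact_support_in \<Omega> f"
  shows "AE x in lebesgue. x \<in> \<Omega> \<longrightarrow> weak_gradient \<Omega> f x = grad f x"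
proof (rule weak_gradient_unique[OF \<Omega>])
  show "has_weak_gradient \<Omega> f (grad f)" using f supp by (rule has_weak_gradient_grad)
  then show "has_weak_gradient \<Omega> f (weak_gradient \<Omega> f)"
    unfolding weak_gradient_def by (rule someI[of "has_weak_gradient \<Omega> f"])
qed

section \<open>Jensen inequality and cutoff functions\<close>

lemma powr_convex_nonneg:
  assumes "(1::real) \<le> p"
  shows "convex_on {0..} (\<lambda>x. x powr p)"
proof (rule convex_onI)
  fix t x y :: real assume t: "0 < t" "t < 1" and xy: "x \<in> {0..}" "y \<in> {0..}"
  have scale: "(c * z) powr p \<le> c * z powr p" if "0 < c" "c < 1" "0 \<le> z" for c z :: real
  proof -
    have "c powr p \<le> c powr 1" using that assms by (intro powr_mono') auto
    then show ?thesis using that by (simp add: powr_mult mult_right_mono)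
  qed
  show "((1 - t) *\<^sub>R x + t *\<^sub>R y) powr p \<le> (1 - t) * x powr p + t * y powr p"
  proof (cases "x = 0 \<or> y = 0")
    case True
    then show ?thesis using scale[of t y] scale[of "1 - t" x] t xy assms by auto
  next
    case False
    then show ?thesis using convex_onD[OF powr_convex[OF assms], of t x y] t xy by auto
  qed
qed simp

text \<open>Jensen's inequality with weights of total mass at most \<open>1\<close>; the missing mass sits at the
  zero of \<open>\<phi>\<close>.\<close>

lemma convex_on_sum_subprob:
  fixes \<phi> :: "real \<Rightarrow> real"
  assumes conv: "convex_on {0..} \<phi>" and "\<phi> 0 = 0" and F: "finite F"
    and l: "\<And>i. i \<in> F \<Longrightarrow> 0 \<le> l i" "sum l F \<le> 1" and t: "\<And>i. i \<in> F \<Longrightarrow> 0 \<le> t i"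
  shows "\<phi> (\<Sum>i\<in>F. l i * t i) \<le> (\<Sum>i\<in>F. l i * \<phi> (t i))"
proof (cases "sum l F = 0")
  case True
  then have "l i = 0" if "i \<in> F" for i using F l that by (simp add: sum_nonneg_eq_0_iff)
  then show ?thesis using \<open>\<phi> 0 = 0\<close> by simp
next
  case False
  define \<Lambda> where "\<Lambda> = sum l F"
  have \<Lambda>: "0 < \<Lambda>" "\<Lambda> \<le> 1" using False l sum_nonneg[of F l] by (auto simp: \<Lambda>_def less_le)
  define z where "z = (\<Sum>i\<in>F. (l i / \<Lambda>) * t i)"
  have z: "0 \<le> z" unfolding z_def using l t \<Lambda> by (intro sum_nonneg mult_nonneg_nonneg) auto
  have "(\<Sum>i\<in>F. l i * t i) = (1 - \<Lambda>) *\<^sub>R 0 + \<Lambda> *\<^sub>R z"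
    using \<Lambda> by (simp add: z_def sum_distrib_left)
  also have "\<phi> \<dots> \<le> (1 - \<Lambda>) * \<phi> 0 + \<Lambda> * \<phi> z"
    using \<Lambda> z by (intro convex_onD[OF conv]) auto
  also have "\<phi> z \<le> (\<Sum>i\<in>F. (l i / \<Lambda>) * \<phi> (t i))"
    proof -
    have "F \<noteq> {}" using False by auto
    then have "\<phi> (\<Sum>i\<in>F. (l i / \<Lambda>) *\<^sub>R t i) \<le> (\<Sum>i\<in>F. (l i / \<Lambda>) * \<phi> (t i))"
      using F False l t \<Lambda>
      by (intro convex_on_sum[OF F _ conv]) (auto simp: \<Lambda>_def simp flip: sum_divide_distrib)
    then show ?thesis by (simp add: z_def)
  qed
  finally show ?thesis using \<Lambda> \<open>\<phi> 0 = 0\<close> by (simp add: sum_distrib_left)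
qed

lemma has_real_derivative_max_0_power:
  fixes t :: real
  shows "((\<lambda>t. max 0 t ^ Suc (Suc m)) has_real_derivative real (Suc (Suc m)) * max 0 t ^ Suc m) (at t)"
proof (cases t "0::real" rule: linorder_cases)
  case less
  have "((\<lambda>t. 0) has_real_derivative 0) (at t)" by simp
  then have "((\<lambda>t. max 0 t ^ Suc (Suc m)) has_real_derivative 0) (at t)"
    by (rule has_field_derivative_transform_within_open[where S = "{..<0}"]) (use less in auto)
  then show ?thesis using less by simp
next
  case equal
  have "((\<lambda>h::real. max 0 h ^ Suc m) \<longlongrightarrow> max 0 0 ^ Suc m) (at 0)"
    by (intro tendsto_intros)
  then have lim: "((\<lambda>h::real. max 0 h ^ Suc m) \<longlongrightarrow> 0) (at 0)" by simp
  have "((\<lambda>h. (max 0 (0 + h) ^ Suc (Suc m) - max 0 0 ^ Suc (Suc m)) / h) \<longlongrightarrow> (0::real)) (at 0)"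
  proof (rule Lim_transform_eventually[OF lim])
    show "\<forall>\<^sub>F h in at 0. max 0 h ^ Suc m = (max 0 (0 + h) ^ Suc (Suc m) - max 0 0 ^ Suc (Suc m)) / (h::real)"
      unfolding eventually_at by (intro exI[of _ 1]) (auto simp: max_def)
  qed
  then show ?thesis using equal by (simp add: DERIV_def)
next
  case greater
  have "((\<lambda>t. t ^ Suc (Suc m)) has_real_derivative real (Suc (Suc m)) * t ^ Suc m) (at t)"
    using DERIV_pow[of "Suc (Suc m)" t] by simp
  then have "((\<lambda>t. max 0 t ^ Suc (Suc m)) has_real_derivative real (Suc (Suc m)) * t ^ Suc m) (at t)"
    by (rule has_field_derivative_transform_within_open[where S = "{0<..}"]) (use greater in auto)
  then show ?thesis using greater by simp
qed

text \<open>A paraboloid cut off at zero: it is positive on the doubled ball and at least \<open>1\<close> on the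
  ball. Its powers with exponent at least \<open>2\<close> are \<open>C\<^sup>1\<close>.\<close>

definition ball_bump :: "'a::euclidean_space \<times> real \<Rightarrow> 'a \<Rightarrow> real" where
  "ball_bump = (\<lambda>(c, r) z. max 0 (4 - ((z - c) \<bullet> (z - c)) / r\<^sup>2))"

lemma ball_bump_bounds: "0 \<le> ball_bump i z" "ball_bump i z \<le> 4"
  by (auto simp: ball_bump_def split: prod.split)

lemma ball_bump_pos_iff:
  assumes "0 < r" shows "0 < ball_bump (c, r) z \<longleftrightarrow> z \<in> ball c (2 * r)"
proof -
  have "(z - c) \<bullet> (z - c) = (dist c z)\<^sup>2"
    by (subst dist_commute) (simp add: dist_norm power2_norm_eq_inner)
  moreover have "(dist c z)\<^sup>2 < 4 * r\<^sup>2 \<longleftrightarrow> dist c z < 2 * r"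
    using assms abs_square_less_1 power2_less_imp_less[of "dist c z" "2 * r"]
      power_strict_mono[of "dist c z" "2 * r" 2]
    by (auto simp: power_mult_distrib)
  ultimately show ?thesis using assms by (auto simp: ball_bump_def field_simps less_max_iff_disj)
qed

lemma ball_bump_ge_1:
  assumes "0 < r" "z \<in> ball c r" shows "1 \<le> ball_bump (c, r) z"
proof -
  have "(z - c) \<bullet> (z - c) = (dist c z)\<^sup>2"
    by (subst dist_commute) (simp add: dist_norm power2_norm_eq_inner)
  moreover have "(dist c z)\<^sup>2 \<le> r\<^sup>2" using assms by (intro power_mono) auto
  then have "(dist c z)\<^sup>2 \<le> 3 * r\<^sup>2" using zero_le_power2[of r] by linarith
  ultimately show ?thesis using assms by (auto simp: ball_bump_def field_simps le_max_iff_disj)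
qed

definition bump_sum :: "('a::euclidean_space \<times> real) set \<Rightarrow> nat \<Rightarrow> 'a \<Rightarrow> real" where
  "bump_sum F k z = (\<Sum>i\<in>F. ball_bump i z ^ k)"

text \<open>With \<open>M\<close> the sum of the \<open>k\<close>-th powers of the bumps, \<open>2 M / (1 + M)\<close> is at least \<open>1\<close> wherever
  \<open>M \<ge> 1\<close>. The \<open>k\<close>-th powers together with the quotient make this a \<open>C\<^sup>1\<close> substitute for the
  maximum of the bumps: the balls may overlap arbitrarily often, and the gradient of a plain sum
  would not be controlled.\<close>

definition cutoff :: "('a::euclidean_space \<times> real) set \<Rightarrow> nat \<Rightarrow> 'a \<Rightarrow> real" where
  "cutoff F k z = 2 * bump_sum F k z / (1 + bump_sum F k z)"

definition cutoff_grad :: "('a::euclidean_space \<times> real) set \<Rightarrow> nat \<Rightarrow> 'a \<Rightarrow> 'a" where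
  "cutoff_grad F k z = (2 / (1 + bump_sum F k z)\<^sup>2) *\<^sub>R
     (\<Sum>i\<in>F. (real k * ball_bump i z ^ (k - 1)) *\<^sub>R ((- 2 / (snd i)\<^sup>2) *\<^sub>R (z - fst i)))"

lemma bump_sum_nonneg: "0 \<le> bump_sum F k z"
  unfolding bump_sum_def by (intro sum_nonneg zero_le_power ball_bump_bounds)

lemma cutoff_bounds: "0 \<le> cutoff F k z"
  using bump_sum_nonneg[of F k z] by (simp add: cutoff_def)

lemma cutoff_ge_1:
  assumes "finite F" "(c, r) \<in> F" "0 < r" "z \<in> ball c r"
  shows "1 \<le> cutoff F k z"
proof -
  have "1 \<le> ball_bump (c, r) z ^ k" using ball_bump_ge_1[OF assms(3,4)] by simp
  also have "\<dots> \<le> bump_sum F k z" unfolding bump_sum_def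
    using assms(1,2) by (intro member_le_sum) (auto intro: ball_bump_bounds zero_le_power)
  finally show ?thesis by (simp add: cutoff_def field_simps)
qed

lemma continuous_ball_bump: "continuous_on UNIV (ball_bump i)"
  by (cases i) (auto simp: ball_bump_def divide_inverse intro!: continuous_intros)

lemma continuous_bump_sum: "continuous_on UNIV (bump_sum F k)"
  unfolding bump_sum_def[abs_def] by (intro continuous_intros continuous_ball_bump)

lemma continuous_cutoff: "continuous_on UNIV (cutoff F k)"
  unfolding cutoff_def[abs_def]
  by (intro continuous_intros continuous_bump_sum) (simp add: bump_sum_nonneg add_nonneg_eq_0_iff)

lemma continuous_cutoff_grad: "continuous_on UNIV (cutoff_grad F k)"
  unfolding cutoff_grad_def[abs_def]
  by (intro continuous_intros continuous_bump_sum continuous_ball_bump)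
    (simp add: bump_sum_nonneg add_nonneg_eq_0_iff)

lemma has_derivative_ball_bump_power:
  "((\<lambda>z. ball_bump i z ^ Suc (Suc m)) has_derivative
     (\<lambda>v. (real (Suc (Suc m)) * ball_bump i z ^ Suc m) * (((- 2 / (snd i)\<^sup>2) *\<^sub>R (z - fst i)) \<bullet> v))) (at z)"
proof -
  obtain c r where i: "i = (c, r)" by (cases i)
  have "((\<lambda>z. 4 - ((z - c) \<bullet> (z - c)) / r\<^sup>2) has_derivative
      (\<lambda>v. ((- 2 / r\<^sup>2) *\<^sub>R (z - c)) \<bullet> v)) (at z)"
    by (auto intro!: derivative_eq_intros simp: divide_inverse inner_commute algebra_simps)
  from has_derivative_compose[OF this has_real_derivative_max_0_power[of m, unfolded has_field_derivative_def]]
  show ?thesis by (simp add: i ball_bump_def)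
qed

lemma has_derivative_cutoff:
  assumes "finite F" "2 \<le> k"
  shows "(cutoff F k has_derivative (\<lambda>v. cutoff_grad F k z \<bullet> v)) (at z)"
proof -
  obtain m where k: "k = Suc (Suc m)" using assms(2) by (metis add_2_eq_Suc le_Suc_ex)
  let ?M' = "\<lambda>v. \<Sum>i\<in>F. (real k * ball_bump i z ^ (k - 1)) * (((- 2 / (snd i)\<^sup>2) *\<^sub>R (z - fst i)) \<bullet> v)"
  have M: "(bump_sum F k has_derivative ?M') (at z)"
    unfolding bump_sum_def[abs_def] k
    using has_derivative_ball_bump_power by (intro has_derivative_sum) simp
  have ne: "1 + bump_sum F k z \<noteq> 0" using bump_sum_nonneg[of F k z] by simp
  have "((\<lambda>t. 2 * t / (1 + t)) has_real_derivative 2 / (1 + bump_sum F k z)\<^sup>2) (at (bump_sum F k z))"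
    using ne by (auto intro!: derivative_eq_intros simp: field_simps power2_eq_square)
  from has_derivative_compose[OF M this[unfolded has_field_derivative_def]]
  have "((\<lambda>z. 2 * bump_sum F k z / (1 + bump_sum F k z)) has_derivative
      (\<lambda>v. 2 / (1 + bump_sum F k z)\<^sup>2 * ?M' v)) (at z)" .
  moreover have "cutoff_grad F k z \<bullet> v = 2 / (1 + bump_sum F k z)\<^sup>2 * ?M' v" for v
    unfolding cutoff_grad_def by (simp only: inner_sum_left inner_scaleR_left)
  ultimately show ?thesis by (simp add: cutoff_def[abs_def])
qed

lemma grad_cutoff:
  assumes "finite F" "2 \<le> k"
  shows "grad (cutoff F k) = cutoff_grad F k"
proof
  fix z
  show "grad (cutoff F k) z = cutoff_grad F k z"
    unfolding grad_def frechet_derivative_eqI[OF has_derivative_cutoff[OF assms]]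
    by (rule euclidean_representation)
qed

lemma C1_cutoff:
  assumes "finite F" "2 \<le> k"
  shows "C1_on UNIV (cutoff F k)"
  using has_derivative_cutoff[OF assms] continuous_cutoff_grad[of F k]
  by (auto simp: C1_on_def grad_cutoff[OF assms] differentiable_def)

lemma cutoff_support:
  assumes F: "finite F" "\<And>c r. (c, r) \<in> F \<Longrightarrow> 0 < r" and k: "2 \<le> k"
    and z: "z \<notin> (\<Union>(c, r)\<in>F. cball c (2 * r))"
  shows "cutoff F k z = 0" "cutoff_grad F k z = 0"
proof -
  have 0: "ball_bump i z = 0" if "i \<in> F" for i
  proof -
    obtain c r where i: "i = (c, r)" by (cases i)
    have "z \<notin> ball c (2 * r)" using z that i by force
    then have "\<not> 0 < ball_bump (c, r) z" using ball_bump_pos_iff[of r c z] F(2) that i by simp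
    then show ?thesis using ball_bump_bounds(1)[of i z] i by simp
  qed
  then show "cutoff F k z = 0" "cutoff_grad F k z = 0"
    using k by (auto simp: cutoff_def cutoff_grad_def bump_sum_def power_0_left)
qed

text \<open>With \<open>y\<^sub>i\<close> the bumps, \<open>y\<^sub>i\<^sup>k\<^sup>-\<^sup>1 = y\<^sub>i\<^sup>k / y\<^sub>i\<close> bounds the gradient by a combination of the
  slopes \<open>8 k / (y\<^sub>i r\<^sub>i)\<close> with weights \<open>y\<^sub>i\<^sup>k / (1 + M)\<^sup>2\<close>. Their sum is at most
  \<open>M / (1 + M)\<^sup>2 \<le> 1\<close>, so that Jensen's inequality can be applied.\<close>

lemma norm_cutoff_grad_le:
  assumes F: "finite F" "\<And>c r. (c, r) \<in> F \<Longrightarrow> 0 < r" and k: "2 \<le> k"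
  shows "norm (cutoff_grad F k z)
    \<le> (\<Sum>i\<in>{i\<in>F. 0 < ball_bump i z}. ball_bump i z ^ k / (1 + bump_sum F k z)\<^sup>2 *
          (8 * real k / ball_bump i z * (1 / snd i)))"
proof -
  let ?m = "(1 + bump_sum F k z)\<^sup>2"
  have m: "0 < ?m" using bump_sum_nonneg[of F k z] by simp
  have "norm (cutoff_grad F k z)
      = 2 / ?m * norm (\<Sum>i\<in>F. (real k * ball_bump i z ^ (k - 1)) *\<^sub>R ((- 2 / (snd i)\<^sup>2) *\<^sub>R (z - fst i)))"
    using m by (simp add: cutoff_grad_def)
  also have "\<dots> \<le> 2 / ?m * (\<Sum>i\<in>F. (real k * ball_bump i z ^ (k - 1)) * (2 / (snd i)\<^sup>2 * dist (fst i) z))"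
  proof (intro mult_left_mono sum_norm_le)
    fix i
    have "\<bar>ball_bump i z ^ (k - 1)\<bar> = ball_bump i z ^ (k - 1)"
      by (intro abs_of_nonneg zero_le_power ball_bump_bounds)
    then show "norm ((real k * ball_bump i z ^ (k - 1)) *\<^sub>R ((- 2 / (snd i)\<^sup>2) *\<^sub>R (z - fst i)))
        \<le> real k * ball_bump i z ^ (k - 1) * (2 / (snd i)\<^sup>2 * dist (fst i) z)"
      by (subst dist_commute) (simp add: dist_norm abs_mult)
  qed (use m in auto)
  also have "\<dots> = (\<Sum>i\<in>{i\<in>F. 0 < ball_bump i z}.
      2 / ?m * ((real k * ball_bump i z ^ (k - 1)) * (2 / (snd i)\<^sup>2 * dist (fst i) z)))"
    unfolding sum_distrib_left
  proof (rule sum.mono_neutral_right)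
    have "ball_bump i z = 0" if "\<not> 0 < ball_bump i z" for i
      using that ball_bump_bounds(1)[of i z] by simp
    then show "\<forall>i\<in>F - {i \<in> F. 0 < ball_bump i z}. 2 / ?m *
        ((real k * ball_bump i z ^ (k - 1)) * (2 / (snd i)\<^sup>2 * dist (fst i) z)) = 0"
      using k by (auto simp: power_0_left)
  qed (use F in auto)
  also have "\<dots> \<le> (\<Sum>i\<in>{i\<in>F. 0 < ball_bump i z}. ball_bump i z ^ k / ?m *
          (8 * real k / ball_bump i z * (1 / snd i)))"
  proof (rule sum_mono)
    fix i assume i: "i \<in> {i\<in>F. 0 < ball_bump i z}"
    define y where "y = ball_bump i z"
    define r where "r = snd i"
    have y: "0 < y" using i by (simp add: y_def)
    have r: "0 < r" using i F(2)[of "fst i" "snd i"] by (simp add: r_def)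
    have "dist (fst i) z \<le> 2 * r"
      using i r ball_bump_pos_iff[of r "fst i" z] by (simp add: r_def)
    then have "2 / ?m * ((real k * y ^ (k - 1)) * (2 / r\<^sup>2 * dist (fst i) z))
        \<le> 2 / ?m * ((real k * y ^ (k - 1)) * (2 / r\<^sup>2 * (2 * r)))"
      using m y by (intro mult_left_mono) auto
    also have "\<dots> = y ^ k / ?m * (8 * real k / y * (1 / r))"
    proof -
      have "2 / M * (c * w * (2 / r\<^sup>2 * (2 * r))) = y * w / M * (8 * c / y * (1 / r))" if "0 < M" for M c w
        using that y r by (simp add: field_simps power2_eq_square)
      moreover have "y ^ k = y * y ^ (k - 1)" using k by (cases k) auto
      ultimately show ?thesis using m by simp
    qed
    finally show "2 / ?m * ((real k * ball_bump i z ^ (k - 1)) * (2 / (snd i)\<^sup>2 * dist (fst i) z))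
        \<le> ball_bump i z ^ k / ?m * (8 * real k / ball_bump i z * (1 / snd i))"
      by (simp add: y_def r_def)
  qed
  finally show ?thesis .
qed

section \<open>Capacity\<close>

context double_phase_coeff
begin

lemma continuous_on_a: "continuous_on \<Omega> a"
  unfolding continuous_on_iff
proof (intro ballI allI impI)
  fix x e assume x: "x \<in> \<Omega>" and e: "(0::real) < e"
  define d where "d = (e / (A + 1)) powr (1 / \<alpha>)"
  have "0 < d" using e A by (simp add: d_def)
  moreover have "dist (a y) (a x) < e" if y: "y \<in> \<Omega>" "dist y x < d" for y
  proof -
    have "dist y x powr \<alpha> \<le> d powr \<alpha>" using y exps by (intro powr_mono2) auto
    also have "\<dots> = e / (A + 1)" using e A exps by (simp add: d_def powr_powr)
    finally have "A * dist y x powr \<alpha> \<le> A * (e / (A + 1))" using A by (intro mult_left_mono)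
    also have "\<dots> < e" using e A by (simp add: field_simps)
    finally show ?thesis using a_holder[OF y(1) x] by (simp add: dist_real_def)
  qed
  ultimately show "\<exists>d>0. \<forall>y\<in>\<Omega>. dist y x < d \<longrightarrow> dist (a y) (a x) < e" by blast
qed

lemma continuous_on_\<Phi>:
  assumes S: "S \<subseteq> \<Omega>" and g: "continuous_on S g" "\<And>x. x \<in> S \<Longrightarrow> 0 \<le> g x"
  shows "continuous_on S (\<lambda>x. \<Phi> x (g x))"
proof -
  have "continuous_on S a" using continuous_on_a S by (rule continuous_on_subset)
  then show ?thesis
    unfolding H_def using g exps S a_nonneg
    by (intro continuous_on_powr' continuous_on_add continuous_on_mult continuous_on_const) auto
qed

lemma \<Phi>_0: "\<Phi> x 0 = 0"
  using exps by (simp add: H_def)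

lemma \<Phi>_mono: "x \<in> \<Omega> \<Longrightarrow> 0 \<le> t \<Longrightarrow> t \<le> t' \<Longrightarrow> \<Phi> x t \<le> \<Phi> x t'"
  unfolding H_def using exps a_nonneg
  by (intro powr_mono2 add_mono mult_left_mono add_nonneg_nonneg mult_nonneg_nonneg) auto

lemma convex_on_\<Phi>:
  assumes x: "x \<in> \<Omega>"
  shows "convex_on {0..} (\<Phi> x)"
proof (rule convex_onI)
  have H: "convex_on {0..} (H a p q x)"
    unfolding H_def[abs_def] using exps a_nonneg[OF x]
    by (intro convex_on_add convex_on_cmul powr_convex_nonneg) auto
  fix t u v :: real assume t: "0 < t" "t < 1" and uv: "u \<in> {0..}" "v \<in> {0..}"
  have "H a p q x ((1 - t) *\<^sub>R u + t *\<^sub>R v) \<le> (1 - t) * H a p q x u + t * H a p q x v"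
    using t uv by (intro convex_onD[OF H]) auto
  then have "\<Phi> x ((1 - t) *\<^sub>R u + t *\<^sub>R v) \<le> ((1 - t) * H a p q x u + t * H a p q x v) powr s"
    using exps H_nonneg[OF x] by (intro powr_mono2) auto
  also have "\<dots> \<le> (1 - t) * \<Phi> x u + t * \<Phi> x v"
    using convex_onD[OF powr_convex_nonneg, of s t "H a p q x u" "H a p q x v"] exps t H_nonneg[OF x]
    by auto
  finally show "\<Phi> x ((1 - t) *\<^sub>R u + t *\<^sub>R v) \<le> (1 - t) * \<Phi> x u + t * \<Phi> x v" .
qed simp

lemma \<Phi>_scale:
  assumes x: "x \<in> \<Omega>" and "1 \<le> c" "0 \<le> t"
  shows "\<Phi> x (c * t) \<le> c powr (q * s) * \<Phi> x t"
proof -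
  have "c powr p \<le> c powr q" using assms exps by (intro powr_mono) auto
  then have "H a p q x (c * t) \<le> c powr q * H a p q x t"
    using assms a_nonneg[OF x] unfolding H_def
    by (simp add: powr_mult distrib_left mult_right_mono mult.left_commute)
  then have "\<Phi> x (c * t) \<le> (c powr q * H a p q x t) powr s"
    using exps H_nonneg[OF x] by (intro powr_mono2) auto
  also have "\<dots> = c powr (q * s) * \<Phi> x t"
    using H_nonneg[OF x] by (simp add: powr_mult powr_powr)
  finally show ?thesis .
qed

text \<open>Large enough that \<open>y\<^sup>k\<close> absorbs the factor \<open>y\<^sup>-\<^sup>q\<^sup>s\<close> that arises from the slopes
  \<open>8 k / (y r)\<close>.\<close>

definition cap_exponent :: nat where "cap_exponent = nat \<lceil>q * s\<rceil>"

definition cap_const :: real where "cap_const = (8 * real cap_exponent) powr (q * s) * 4 ^ cap_exponent"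

lemma cap_exponent_bounds: "q * s \<le> real cap_exponent" "2 \<le> cap_exponent"
proof -
  have "1 * 1 < q * s" using exps by (intro mult_less_le_imp_less) auto
  then show "q * s \<le> real cap_exponent" "2 \<le> cap_exponent"
    unfolding cap_exponent_def by linarith+
qed

lemma cap_const_pos: "0 < cap_const"
  using cap_exponent_bounds(2) by (simp add: cap_const_def)

text \<open>By convexity of \<open>\<Phi>(z, \<cdot>)\<close> the weights of \<open>norm_cutoff_grad_le\<close> come out of \<open>\<Phi>\<close>; each slope
  then costs \<open>(8 k / y\<^sub>i)\<^sup>q\<^sup>s\<close>, and \<open>y\<^sub>i\<^sup>k (8 k / y\<^sub>i)\<^sup>q\<^sup>s\<close> is bounded because \<open>y\<^sub>i \<le> 4\<close> and
  \<open>k \<ge> q s\<close>. The number of overlapping balls does not enter.\<close>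

lemma \<Phi>_cutoff_grad_le:
  fixes F :: "('a \<times> real) set"
  assumes F: "finite F" "\<And>c r. (c, r) \<in> F \<Longrightarrow> 0 < r" and z: "z \<in> \<Omega>"
  shows "\<Phi> z (norm (cutoff_grad F cap_exponent z))
    \<le> (\<Sum>(c, r)\<in>F. cap_const * (indicator (ball c (2 * r)) z * \<Phi> z (1 / r)))"
proof -
  let ?k = cap_exponent
  let ?m = "(1 + bump_sum F ?k z)\<^sup>2"
  define P where "P = {i\<in>F. 0 < ball_bump i z}"
  define l where "l i = ball_bump i z ^ ?k / ?m" for i
  define t where "t i = 8 * real ?k / ball_bump i z * (1 / snd i)" for i
  have P: "finite P" "P \<subseteq> F" using F by (auto simp: P_def)
  have r: "0 < snd i" if "i \<in> F" for i using F(2)[of "fst i" "snd i"] that by simp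
  have M: "0 \<le> bump_sum F ?k z" by (rule bump_sum_nonneg)
  have m: "1 + bump_sum F ?k z \<le> ?m" "1 \<le> ?m"
    using M by (auto simp: power2_eq_square intro: order_trans[of 1 "1 + bump_sum F ?k z"])
  have l: "0 \<le> l i" "l i \<le> ball_bump i z ^ ?k" for i
    using m(2) ball_bump_bounds(1)[of i z]
    by (auto simp: l_def divide_le_eq mult_le_cancel_left1 zero_less_power zero_le_power)
  have t: "0 \<le> t i" if "i \<in> F" for i
    using r[OF that] ball_bump_bounds(1)[of i z] by (simp add: t_def)
  have "sum l P \<le> sum l F" using F P l by (intro sum_mono2) auto
  also have "\<dots> = bump_sum F ?k z / ?m" by (simp add: l_def[abs_def] bump_sum_def sum_divide_distrib)
  also have "\<dots> \<le> 1" using M m by simp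
  finally have l1: "sum l P \<le> 1" .
  have "\<Phi> z (norm (cutoff_grad F ?k z)) \<le> \<Phi> z (\<Sum>i\<in>P. l i * t i)"
    using norm_cutoff_grad_le[where z = z, OF F cap_exponent_bounds(2)]
    by (intro \<Phi>_mono z) (auto simp: P_def l_def t_def)
  also have "\<dots> \<le> (\<Sum>i\<in>P. l i * \<Phi> z (t i))"
    using P l(1) l1 t by (intro convex_on_sum_subprob convex_on_\<Phi> z \<Phi>_0) auto
  also have "\<dots> \<le> (\<Sum>i\<in>P. cap_const * \<Phi> z (1 / snd i))"
  proof (rule sum_mono)
    fix i assume i: "i \<in> P"
    define y where "y = ball_bump i z"
    have y: "0 < y" "y \<le> 4" using i ball_bump_bounds(2)[of i z] by (auto simp: y_def P_def)
    have "0 < snd i" using i P by (intro r) blast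
    have "l i * \<Phi> z (t i) \<le> y ^ ?k * ((8 * real ?k / y) powr (q * s) * \<Phi> z (1 / snd i))"
    proof (rule mult_mono)
      show "l i \<le> y ^ ?k" using l by (simp add: y_def)
      show "\<Phi> z (t i) \<le> (8 * real ?k / y) powr (q * s) * \<Phi> z (1 / snd i)"
        unfolding t_def y_def[symmetric]
      proof (rule \<Phi>_scale[OF z])
        have "y \<le> 8 * real ?k" using y cap_exponent_bounds(2) by linarith
        then show "1 \<le> 8 * real ?k / y" using y by simp
      qed (use \<open>0 < snd i\<close> in simp)
    qed (use y in auto)
    also have "\<dots> = (8 * real ?k) powr (q * s) * y powr (real ?k - q * s) * \<Phi> z (1 / snd i)"
      using y by (simp add: powr_divide powr_diff powr_realpow)
    also have "\<dots> \<le> (8 * real ?k) powr (q * s) * 4 powr real ?k * \<Phi> z (1 / snd i)"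
    proof (intro mult_right_mono mult_left_mono)
      have "y powr (real ?k - q * s) \<le> 4 powr (real ?k - q * s)"
        using y cap_exponent_bounds(1) by (intro powr_mono2) auto
      also have "\<dots> \<le> 4 powr real ?k" using exps by (intro powr_mono) auto
      finally show "y powr (real ?k - q * s) \<le> 4 powr real ?k" .
    qed auto
    also have "\<dots> = cap_const * \<Phi> z (1 / snd i)" by (simp add: cap_const_def powr_realpow)
    finally show "l i * \<Phi> z (t i) \<le> cap_const * \<Phi> z (1 / snd i)" .
  qed
  also have "\<dots> = (\<Sum>i\<in>P. cap_const * (indicator (ball (fst i) (2 * snd i)) z * \<Phi> z (1 / snd i)))"
  proof (rule sum.cong[OF refl])
    fix i assume "i \<in> P"
    then have "z \<in> ball (fst i) (2 * snd i)"
      using ball_bump_pos_iff[of "snd i" "fst i" z] r[of i] by (simp add: P_def)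
    then show "cap_const * \<Phi> z (1 / snd i) = cap_const * (indicator (ball (fst i) (2 * snd i)) z * \<Phi> z (1 / snd i))"
      by simp
  qed
  also have "\<dots> \<le> (\<Sum>i\<in>F. cap_const * (indicator (ball (fst i) (2 * snd i)) z * \<Phi> z (1 / snd i)))"
    using F P cap_const_pos by (intro sum_mono2) auto
  finally show ?thesis by (simp add: case_prod_beta)
qed

lemma integrable_on_\<Omega>_of_compact_support:
  fixes f :: "'a \<Rightarrow> 'b::euclidean_space"
  assumes K: "compact K" "K \<subseteq> \<Omega>" and f: "continuous_on K f" and zero: "\<And>x. x \<in> \<Omega> \<Longrightarrow> x \<notin> K \<Longrightarrow> f x = 0"
  shows "f absolutely_integrable_on \<Omega>"
proof -
  have "integrable lborel (\<lambda>x. indicator K x *\<^sub>R f x)" using K f by (intro borel_integrable_compact)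
  then have "integrable lebesgue (\<lambda>x. indicator K x *\<^sub>R f x)" by (simp add: integrable_completion)
  moreover have "(\<lambda>x. indicator K x *\<^sub>R f x) = (\<lambda>x. indicator \<Omega> x *\<^sub>R f x)"
    using K zero by (force split: split_indicator)
  ultimately show ?thesis by (simp add: set_integrable_def)
qed

text \<open>The cutoff function of a finite cover is admissible for the capacity, and its energy is at
  most a constant times the sum of the doubled gauges.\<close>

lemma cap_compact_le:
  fixes F :: "('a \<times> real) set"
  assumes F: "finite F" "\<And>c r. (c, r) \<in> F \<Longrightarrow> 0 < r \<and> cball c (2 * r) \<subseteq> \<Omega>"
    and K: "K \<subseteq> (\<Union>(c, r)\<in>F. ball c r)"
  shows "cap_compact \<Omega> \<Phi> K \<le> ennreal cap_const * sum (doubled_gauge \<Phi>) F"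
proof -
  let ?f = "cutoff F cap_exponent" and ?g = "cutoff_grad F cap_exponent"
  note k = cap_exponent_bounds(2)
  have F0: "\<And>c r. (c, r) \<in> F \<Longrightarrow> 0 < r" using F(2) by blast
  define S where "S = (\<Union>(c, r)\<in>F. cball c (2 * r))"
  have S: "compact S" "S \<subseteq> \<Omega>" using F unfolding S_def by (auto intro!: compact_UN)
  have zero: "?f z = 0" "?g z = 0" if "z \<notin> S" for z
    using cutoff_support[OF F(1) F0 k] that by (auto simp: S_def)
  have supp: "compact_support_in \<Omega> ?f"
  proof -
    have "{z. ?f z \<noteq> 0} \<subseteq> S" using zero by blast
    then have "closure {z. ?f z \<noteq> 0} \<subseteq> S" using S by (intro closure_minimal compact_imp_closed)
    moreover from this have "compact (closure {z. ?f z \<noteq> 0})"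
      using S by (meson closed_closure compact_imp_bounded bounded_subset compact_eq_bounded_closed)
    ultimately show ?thesis using S by (auto simp: compact_support_in_def)
  qed
  have C1: "C1_on UNIV ?f" using C1_cutoff[OF F(1) k] .
  have g: "AE z in lebesgue. z \<in> \<Omega> \<longrightarrow> weak_gradient \<Omega> ?f z = ?g z"
    using weak_gradient_eq_grad[OF open_\<Omega> C1 supp] by (simp add: grad_cutoff[OF F(1) k])
  then obtain N where N: "negligible N" "\<And>z. z \<in> \<Omega> - N \<Longrightarrow> weak_gradient \<Omega> ?f z = ?g z"
    by (auto simp: eventually_ae_filter negligible_iff_null_sets)
  have "?f \<in> W1Phi \<Omega> \<Phi>"
    unfolding W1Phi_def
  proof (intro CollectI conjI)
    show "\<exists>g. has_weak_gradient \<Omega> ?f g" using has_weak_gradient_grad[OF C1 supp] by blast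
    show "?f absolutely_integrable_on \<Omega>"
      using S zero continuous_on_subset[OF continuous_cutoff]
      by (intro integrable_on_\<Omega>_of_compact_support) auto
    have "?g absolutely_integrable_on \<Omega>"
      using S zero continuous_on_subset[OF continuous_cutoff_grad]
      by (intro integrable_on_\<Omega>_of_compact_support) auto
    then show "weak_gradient \<Omega> ?f absolutely_integrable_on \<Omega>"
      using N by (rule absolutely_integrable_spike)
    have cS: "continuous_on S ?f" "continuous_on S ?g"
      using continuous_on_subset[OF continuous_cutoff] continuous_on_subset[OF continuous_cutoff_grad]
      by auto
    have "(\<lambda>z. \<Phi> z \<bar>?f z\<bar> + \<Phi> z (norm (?g z))) absolutely_integrable_on \<Omega>"
    proof (rule integrable_on_\<Omega>_of_compact_support[OF S])
      show "continuous_on S (\<lambda>z. \<Phi> z \<bar>?f z\<bar> + \<Phi> z (norm (?g z)))"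
        using cS by (intro continuous_on_add continuous_on_\<Phi> S(2) continuous_on_rabs continuous_on_norm) auto
    qed (simp add: zero \<Phi>_0)
    then show "(\<lambda>z. \<Phi> z \<bar>?f z\<bar> + \<Phi> z (norm (weak_gradient \<Omega> ?f z))) absolutely_integrable_on \<Omega>"
      by (rule absolutely_integrable_spike[OF _ N(1)]) (simp add: N(2))
  qed
  moreover have "?f \<in> C0 \<Omega>" using supp continuous_cutoff by (simp add: C0_def)
  moreover have "1 \<le> ?f z" if z: "z \<in> K" for z
  proof -
    obtain c r where "(c, r) \<in> F" "z \<in> ball c r" using z K by blast
    then show ?thesis using F(1) F0 by (intro cutoff_ge_1)
  qed
  ultimately have "cap_compact \<Omega> \<Phi> K \<le> (\<integral>\<^sup>+z\<in>\<Omega>. ennreal (\<Phi> z (norm (weak_gradient \<Omega> ?f z))) \<partial>lebesgue)"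
    unfolding cap_compact_def by (intro INF_lower) (auto intro: cutoff_bounds)
  also have "\<dots> \<le> (\<integral>\<^sup>+z. (\<Sum>(c, r)\<in>F. ennreal cap_const * (ennreal (\<Phi> z (1 / r)) * indicator (ball c (2 * r)) z)) \<partial>lebesgue)"
  proof (rule nn_integral_mono_AE)
    show "AE z in lebesgue. ennreal (\<Phi> z (norm (weak_gradient \<Omega> ?f z))) * indicator \<Omega> z
        \<le> (\<Sum>(c, r)\<in>F. ennreal cap_const * (ennreal (\<Phi> z (1 / r)) * indicator (ball c (2 * r)) z))"
      using g
    proof eventually_elim
      case (elim z)
      show ?case
      proof (cases "z \<in> \<Omega>")
        case True
        have "ennreal (\<Phi> z (norm (?g z)))
            \<le> ennreal (\<Sum>(c, r)\<in>F. cap_const * (indicator (ball c (2 * r)) z * \<Phi> z (1 / r)))"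
          using \<Phi>_cutoff_grad_le[OF F(1) F0 True] by (rule ennreal_leI)
        also have "\<dots> = (\<Sum>i\<in>F. ennreal (case i of (c, r) \<Rightarrow> cap_const * (indicator (ball c (2 * r)) z * \<Phi> z (1 / r))))"
          using cap_const_pos by (intro sum_ennreal[symmetric]) (auto split: prod.split)
        also have "\<dots> = (\<Sum>(c, r)\<in>F. ennreal cap_const * (ennreal (\<Phi> z (1 / r)) * indicator (ball c (2 * r)) z))"
          using cap_const_pos by (intro sum.cong refl) (auto simp: ennreal_mult split: prod.split split_indicator)
        finally show ?thesis using elim True by simp
      qed simp
    qed
  qed
  also have "\<dots> = (\<Sum>i\<in>F. ennreal cap_const * doubled_gauge \<Phi> i)"
  proof -
    have meas: "(\<lambda>z. ennreal (\<Phi> z (1 / r)) * indicator (ball c (2 * r)) z) \<in> borel_measurable lebesgue"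
      if "(c, r) \<in> F" for c r
    proof -
      have "ball c (2 * r) \<subseteq> \<Omega>" using F(2)[OF that] ball_subset_cball by blast
      then have "continuous_on (ball c (2 * r)) (\<lambda>z. \<Phi> z (1 / r))"
        using F0[OF that] by (intro continuous_on_\<Phi> continuous_on_const) auto
      then have "(\<lambda>z. indicator (ball c (2 * r)) z *\<^sub>R \<Phi> z (1 / r)) \<in> borel_measurable borel"
        by (intro borel_measurable_continuous_on_indicator) auto
      then have "(\<lambda>z. ennreal (indicator (ball c (2 * r)) z *\<^sub>R \<Phi> z (1 / r))) \<in> borel_measurable lebesgue"
        by (intro measurable_compose[OF _ measurable_ennreal] measurable_completion) simp
      moreover have "(\<lambda>z. ennreal (indicator (ball c (2 * r)) z *\<^sub>R \<Phi> z (1 / r)))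
          = (\<lambda>z. ennreal (\<Phi> z (1 / r)) * indicator (ball c (2 * r)) z)"
        by (auto split: split_indicator)
      ultimately show ?thesis by (simp only:)
    qed
    have "(\<integral>\<^sup>+z. (\<Sum>(c, r)\<in>F. ennreal cap_const * (ennreal (\<Phi> z (1 / r)) * indicator (ball c (2 * r)) z)) \<partial>lebesgue)
        = (\<Sum>i\<in>F. \<integral>\<^sup>+z. (case i of (c, r) \<Rightarrow>
            ennreal cap_const * (ennreal (\<Phi> z (1 / r)) * indicator (ball c (2 * r)) z)) \<partial>lebesgue)"
      using meas by (intro nn_integral_sum) auto
    also have "\<dots> = (\<Sum>i\<in>F. ennreal cap_const * doubled_gauge \<Phi> i)"
      using meas by (intro sum.cong refl) (auto simp: doubled_gauge_def nn_integral_cmult)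
    finally show ?thesis .
  qed
  finally show ?thesis by (simp add: sum_distrib_left)
qed

text \<open>The union of a cover is an open superset, and each of its compact subsets is covered by
  finitely many of the balls.\<close>

theorem capacity_of_gauge_null:
  assumes E: "gauge_null \<Omega> (doubled_gauge \<Phi>) E"
  shows "capacity \<Omega> \<Phi> E = 0"
proof -
  have le: "capacity \<Omega> \<Phi> E \<le> 0 + ennreal \<epsilon>" if \<epsilon>: "0 < \<epsilon>" for \<epsilon>
  proof -
    have "0 < \<epsilon> / cap_const" using \<epsilon> cap_const_pos by simp
    then obtain C where C: "\<forall>(c, r)\<in>C. 0 < r \<and> r \<le> 1 \<and> cball c (2 * r) \<subseteq> \<Omega>"
      "E \<subseteq> (\<Union>(c, r)\<in>C. ball c r)"
      "\<forall>F. finite F \<longrightarrow> F \<subseteq> C \<longrightarrow> sum (doubled_gauge \<Phi>) F \<le> ennreal (\<epsilon> / cap_const)"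
      using E zero_less_one unfolding gauge_null_def by meson
    define U where "U = (\<Union>(c, r)\<in>C. ball c r)"
    have "ball c r \<subseteq> \<Omega>" if "(c, r) \<in> C" for c r
      by (rule ball_subset_of_double[of r]) (use that C(1) in auto)
    then have U: "open U" "E \<subseteq> U" "U \<subseteq> \<Omega>" using C(2) by (auto simp: U_def)
    have "cap_compact \<Omega> \<Phi> K \<le> ennreal \<epsilon>" if K: "compact K" "K \<subseteq> U" for K
    proof -
      obtain F where F: "F \<subseteq> C" "finite F" "K \<subseteq> (\<Union>i\<in>F. case i of (c, r) \<Rightarrow> ball c r)"
        using compactE_image[OF K(1), of C "\<lambda>i. case i of (c, r) \<Rightarrow> ball c r"] K(2)
        by (auto simp: U_def split: prod.splits)
      have "cap_compact \<Omega> \<Phi> K \<le> ennreal cap_const * sum (doubled_gauge \<Phi>) F"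
      proof (rule cap_compact_le[OF F(2) _ F(3)])
        show "0 < r \<and> cball c (2 * r) \<subseteq> \<Omega>" if "(c, r) \<in> F" for c r using that F(1) C(1) by blast
      qed
      also have "\<dots> \<le> ennreal cap_const * ennreal (\<epsilon> / cap_const)" using C(3) F by (intro mult_left_mono) auto
      also have "\<dots> = ennreal \<epsilon>" using \<epsilon> cap_const_pos by (simp flip: ennreal_mult)
      finally show ?thesis .
    qed
    then have "cap_open \<Omega> \<Phi> U \<le> ennreal \<epsilon>" unfolding cap_open_def by (intro SUP_least) auto
    moreover have "capacity \<Omega> \<Phi> E \<le> cap_open \<Omega> \<Phi> U"
      unfolding capacity_def using U by (intro INF_lower) auto
    ultimately show ?thesis by simp
  qed
  have "capacity \<Omega> \<Phi> E \<le> 0" by (rule ennreal_le_epsilon) (rule le)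
  then show ?thesis by simp
qed

end

section \<open>The singular set of a local minimizer\<close>

text \<open>The supremum of an empty set of quotients is unspecified, hence the maximum with \<open>0\<close>.\<close>

lemma double_phase_coeff_of_problem:
  assumes "double_phase_problem \<nu> L p q \<alpha> \<beta> \<beta>1 \<Omega> a F" and "1 \<le> s"
  shows "double_phase_coeff p q \<alpha> s (max 0 (holder_seminorm \<alpha> a \<Omega>)) \<Omega> a"
proof -
  interpret double_phase_problem \<nu> L p q \<alpha> \<beta> \<beta>1 \<Omega> a F by fact
  show ?thesis
  proof
    fix x y assume xy: "x \<in> \<Omega>" "y \<in> \<Omega>"
    show "\<bar>a x - a y\<bar> \<le> max 0 (holder_seminorm \<alpha> a \<Omega>) * dist x y powr \<alpha>"
    proof (cases "x = y")
      case False
      have "\<bar>a x - a y\<bar> / dist x y powr \<alpha> \<in> holder_quotients \<alpha> a \<Omega>"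
        using xy False by (auto simp: holder_quotients_def)
      then have "\<bar>a x - a y\<bar> / dist x y powr \<alpha> \<le> holder_seminorm \<alpha> a \<Omega>"
        unfolding holder_seminorm_def using coeff_holder
        by (intro cSup_upper) (auto simp: holder_continuous_on_def)
      then have "\<bar>a x - a y\<bar> \<le> holder_seminorm \<alpha> a \<Omega> * dist x y powr \<alpha>"
        using False by (simp add: divide_le_eq)
      also have "\<dots> \<le> max 0 (holder_seminorm \<alpha> a \<Omega>) * dist x y powr \<alpha>"
        by (intro mult_right_mono) auto
      finally show ?thesis .
    qed simp
  qed (use exponents domain coeff_nonneg assms(2) in auto)
qed

theorem theorem3:
  fixes \<nu> L p q \<alpha> \<beta> \<beta>1 \<delta>g :: real
    and \<Omega> :: "(real^'n) set"
    and a :: "real^'n \<Rightarrow> real"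
    and F :: "real^'n \<Rightarrow> real^'m \<Rightarrow> real^'n^'m \<Rightarrow> real"
    and u :: "real^'n \<Rightarrow> real^'m"
  assumes "double_phase_problem \<nu> L p q \<alpha> \<beta> \<beta>1 \<Omega> a F"
    and "higher_integrability_exponent TYPE('n) TYPE('m) \<nu> L p q \<alpha> (holder_seminorm \<alpha> a \<Omega>) \<delta>g"
    and "local_minimizer p q \<Omega> a F u"
    and "q * (1 + \<delta>g) \<le> real CARD('n)"
  shows "weighted_hausdorff \<Omega> (\<lambda>x t. H a p q x t powr (1 + \<delta>g)) (\<Omega> - regular_set p q \<Omega> a u) = 0 \<and>
         capacity \<Omega> (\<lambda>x t. H a p q x t powr (1 + \<delta>g)) (\<Omega> - regular_set p q \<Omega> a u) = 0 \<and>
         hausdorff_measure (real CARD('n) - p - p * \<delta>g) (singular_set p q \<Omega> a u) = 0 \<and>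
         hausdorff_measure (real CARD('n) - q - q * \<delta>g)
           (singular_set p q \<Omega> a u \<inter> {x \<in> \<Omega>. a x > 0}) = 0"
proof -
  have \<delta>: "0 < \<delta>g"
    and Gs: "L1_loc \<Omega> (\<lambda>x. H a p q x (norm (weak_jacobian \<Omega> u x)) powr (1 + \<delta>g))"
    using assms(1-3) unfolding higher_integrability_exponent_def by blast+
  have G: "L1_loc \<Omega> (\<lambda>x. H a p q x (norm (weak_jacobian \<Omega> u x)))"
    using assms(3) unfolding local_minimizer_def by blast
  interpret double_phase_coeff p q \<alpha> "1 + \<delta>g" "max 0 (holder_seminorm \<alpha> a \<Omega>)" \<Omega> a
    using \<delta> by (intro double_phase_coeff_of_problem[OF assms(1)]) simp
  let ?S = "singular_set p q \<Omega> a u"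
  have null: "gauge_null \<Omega> (doubled_gauge \<Phi>) ?S"
    using gauge_null_Limsup_means[OF G Gs] unfolding singular_set_def .
  have S: "?S \<subseteq> \<Omega>" by (auto simp: singular_set_def)
  then have reg: "\<Omega> - regular_set p q \<Omega> a u = ?S" by (auto simp: regular_set_def)
  have dq: "0 \<le> real DIM(real^'n) - q * (1 + \<delta>g)" using assms(4) by simp
  moreover have "p * (1 + \<delta>g) \<le> q * (1 + \<delta>g)" using exps \<delta> by (intro mult_right_mono) auto
  ultimately have dp: "0 \<le> real DIM(real^'n) - p * (1 + \<delta>g)" by linarith
  have eq: "real CARD('n) - e - e * \<delta>g = real DIM(real^'n) - e * (1 + \<delta>g)" for e
    by (simp add: algebra_simps)
  show ?thesis
    unfolding reg eq
    using weighted_hausdorff_of_gauge_null[OF null] capacity_of_gauge_null[OF null]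
      hausdorff_measure_of_gauge_null[OF null dp] hausdorff_measure_of_gauge_null_pos[OF null dq S]
    by blast
qed

end
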